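(* Let $k\ge 3$ be an integer. In the message-passing model with $s$ players and no edge duplication, the communication cost of computing a multiplicative $(2k-1)$-spanner of an $n$-vertex input graph is $\tilde O\big(k s^{1-2/k} n^{1+1/k}+snk\big)$ bits.
   Context: Message-passing model: there are $s$ players $P^1,\dots,P^s$ and a coordinator. All parties know the vertex set $V$, $|V|=n$; player $P^i$ holds an edge set $E_i$ on $V$, and the input graph is $G=(V,\bigcup_i E_i)$ (unweighted, undirected). Communication is only between the coordinator and individual players; the coordinator must output the spanner. Communication cost is the total number of bits exchanged; randomized protocols (allowed) must succeed with high/constant probability on every input. "No edge duplication" means the $E_i$ are pairwise disjoint. A multiplicative $\alpha$-spanner of $G$ is a subgraph $H$ with $d_H(u,v)\le \alpha\, d_G(u,v)$ for all $u,v$. $\tilde O$ hides $\mathrm{poly}(\log n)$ factors. Standing assumption: $s\ll n$. *)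

theory Defs
  imports "HOL-Probability.Probability"
begin

text \<open>A graph on the vertex set \<open>{..<n}\<close> is given by its set of edges, which are two-element subsets
  of \<open>{..<n}\<close>.\<close>

definition all_edges :: "nat \<Rightarrow> nat set set" where
  "all_edges n = {e. e \<subseteq> {..<n} \<and> card e = 2}"

text \<open>A walk of length \<open>l\<close> is an \<open>l\<close>-fold composition of the adjacency relation. The distance of
  disconnected vertices is \<open>\<infinity>\<close>, the infimum of the empty set in \<^typ>\<open>enat\<close>.\<close>

definition gdist :: "nat set set \<Rightarrow> nat \<Rightarrow> nat \<Rightarrow> enat" where
  "gdist E u v = (INF l\<in>{l. (u, v) \<in> {(x, y). {x, y} \<in> E} ^^ l}. enat l)"

definition is_spanner :: "nat \<Rightarrow> nat \<Rightarrow> nat set set \<Rightarrow> nat set set \<Rightarrow> bool" where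
  "is_spanner n \<alpha> E H \<longleftrightarrow>
     H \<subseteq> E \<and> (\<forall>u<n. \<forall>v<n. gdist H u v \<le> enat \<alpha> * gdist E u v)"

text \<open>Player \<open>i < s\<close> holds the edge set \<open>X i\<close>; disjointness expresses that there is no edge duplication.\<close>

definition inputs :: "nat \<Rightarrow> nat \<Rightarrow> (nat \<Rightarrow> nat set set) set" where
  "inputs n s = {X. (\<forall>i<s. X i \<subseteq> all_edges n) \<and> disjoint_family_on X {..<s}}"

definition input_graph :: "nat \<Rightarrow> (nat \<Rightarrow> nat set set) \<Rightarrow> nat set set" where
  "input_graph s X = (\<Union>i<s. X i)"

text \<open>
  A protocol is described bit by bit. The coordinator shares a private channel with every player,
  and the history of a channel is the list of bits sent over it so far, in either direction.
  Whose turn it is on a channel depends only on the history of that channel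
  (\<open>coord_turn\<close>), so both of its ends know who speaks next, and neither message boundaries nor
  silence carry free information. Longer messages are sequences of bits.

  The transcript is the list of all pairs (channel, bit) in order. The coordinator sees all of it,
  and after each bit decides over which channel the next bit goes, or to stop (\<open>None\<close>).
  Player \<open>i\<close> sees only its own edge set, its own coins and the history of channel \<open>i\<close>.
  All parties have private and independent coins, each given by a random natural number.
\<close>

record protocol =
  coord_coins :: "nat pmf"
  player_coins :: "nat \<Rightarrow> nat pmf"
  coord_turn :: "nat \<Rightarrow> bool list \<Rightarrow> bool"
    \<comment> \<open>channel, history of the channel\<close>
  next_channel :: "nat \<Rightarrow> (nat \<times> bool) list \<Rightarrow> nat option"
    \<comment> \<open>coins of the coordinator, transcript\<close>
  coord_bit :: "nat \<Rightarrow> (nat \<times> bool) list \<Rightarrow> bool"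
    \<comment> \<open>coins of the coordinator, transcript\<close>
  player_bit :: "nat \<Rightarrow> nat \<Rightarrow> nat set set \<Rightarrow> bool list \<Rightarrow> bool"
    \<comment> \<open>player, its coins, its edge set, history of its channel\<close>
  coord_output :: "nat \<Rightarrow> (nat \<times> bool) list \<Rightarrow> nat set set"
    \<comment> \<open>coins of the coordinator, final transcript\<close>

definition has_players :: "nat \<Rightarrow> protocol \<Rightarrow> bool" where
  "has_players s P \<longleftrightarrow> (\<forall>c \<tau> i. next_channel P c \<tau> = Some i \<longrightarrow> i < s)"

definition channel :: "nat \<Rightarrow> (nat \<times> bool) list \<Rightarrow> bool list" where
  "channel i \<tau> = map snd (filter (\<lambda>m. fst m = i) \<tau>)"

text \<open>In the following, the pair \<open>(c, r)\<close> consists of the coins \<open>c\<close> of the coordinator and the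
  coins \<open>r i\<close> of the players \<open>i\<close>.\<close>

definition coins :: "nat \<Rightarrow> protocol \<Rightarrow> (nat \<times> (nat \<Rightarrow> nat)) pmf" where
  "coins s P = pair_pmf (coord_coins P) (Pi_pmf {..<s} 0 (player_coins P))"

definition next_bit ::
  "protocol \<Rightarrow> (nat \<Rightarrow> nat set set) \<Rightarrow> nat \<times> (nat \<Rightarrow> nat) \<Rightarrow> (nat \<times> bool) list \<Rightarrow> nat \<Rightarrow> bool" where
  "next_bit P X = (\<lambda>(c, r) \<tau> i.
     if coord_turn P i (channel i \<tau>) then coord_bit P c \<tau>
     else player_bit P i (r i) (X i) (channel i \<tau>))"

text \<open>The transcript after \<open>t\<close> bits, or the final transcript if the coordinator has stopped
  earlier.\<close>

primrec transcript ::
  "protocol \<Rightarrow> (nat \<Rightarrow> nat set set) \<Rightarrow> nat \<times> (nat \<Rightarrow> nat) \<Rightarrow> nat \<Rightarrow> (nat \<times> bool) list" where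
  "transcript P X \<omega> 0 = []"
| "transcript P X \<omega> (Suc t) =
     (let \<tau> = transcript P X \<omega> t in
      case next_channel P (fst \<omega>) \<tau> of
        None \<Rightarrow> \<tau>
      | Some i \<Rightarrow> \<tau> @ [(i, next_bit P X \<omega> \<tau> i)])"

definition halted ::
  "protocol \<Rightarrow> (nat \<Rightarrow> nat set set) \<Rightarrow> nat \<times> (nat \<Rightarrow> nat) \<Rightarrow> nat \<Rightarrow> bool" where
  "halted P X \<omega> t \<longleftrightarrow> next_channel P (fst \<omega>) (transcript P X \<omega> t) = None"

text \<open>The number of bits exchanged in a run, \<open>\<infinity>\<close> if the run does not halt.\<close>

definition bits_exchanged ::
  "protocol \<Rightarrow> (nat \<Rightarrow> nat set set) \<Rightarrow> nat \<times> (nat \<Rightarrow> nat) \<Rightarrow> enat" where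
  "bits_exchanged P X \<omega> = (INF t\<in>{t. halted P X \<omega> t}. enat t)"

text \<open>Worst case over all inputs and all outcomes of the coins.\<close>

definition comm_cost :: "nat \<Rightarrow> nat \<Rightarrow> protocol \<Rightarrow> enat" where
  "comm_cost n s P = (SUP X\<in>inputs n s. SUP \<omega>\<in>set_pmf (coins s P). bits_exchanged P X \<omega>)"

definition outputs_spanner ::
  "nat \<Rightarrow> nat \<Rightarrow> nat \<Rightarrow> protocol \<Rightarrow> (nat \<Rightarrow> nat set set) \<Rightarrow> nat \<times> (nat \<Rightarrow> nat) \<Rightarrow> bool" where
  "outputs_spanner n s \<alpha> P X \<omega> \<longleftrightarrow>
     (\<exists>t. halted P X \<omega> t \<and>
          is_spanner n \<alpha> (input_graph s X) (coord_output P (fst \<omega>) (transcript P X \<omega> t)))"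

definition computes_spanner :: "nat \<Rightarrow> nat \<Rightarrow> nat \<Rightarrow> real \<Rightarrow> protocol \<Rightarrow> bool" where
  "computes_spanner n s \<alpha> p P \<longleftrightarrow>
     has_players s P \<and>
     (\<forall>X\<in>inputs n s. measure_pmf.prob (coins s P) {\<omega>. outputs_spanner n s \<alpha> P X \<omega>} \<ge> p)"

end

(*
  A deterministic protocol suffices. Put q = max 1 ((n / s^2) powr (1 / k)) and grow clusterings
  C_0, C_1, ..., where C_0 consists of singletons and a cluster of C_r has radius at most r in the
  spanner H. From C_r the next clustering is obtained by visiting the centers one by one. At a
  center z every player offers those of its edges that join a vertex without a new cluster to the
  cluster of z, one edge per vertex. All offered edges enter H, and if there are at least
  T = s n q / |C_r| of them, then all offered vertices form a new cluster with center z. An edge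
  between two clustered vertices one of which gets no new cluster has stretch at most 2 r + 1.
  A vertex is offered by at most s players, so a new cluster has at least T / s vertices and
  |C_{r+1}| <= |C_r| / q. For C_0 an offer is an edge to z, and since no edge is duplicated a new
  cluster even has T vertices; this gives |C_1| <= n / (s q). Finally C_i and C_j with i + j = k - 1
  are linked by one edge per pair of clusters and player, at the cost of
  s |C_i| |C_j| <= n^2 / (s q^(k-1)) <= s n q edges. Every level also costs O(s n q) messages of
  O(log n) bits, and s n q <= s n + s powr (1 - 2 / k) * n powr (1 + 1 / k).
*)

theory Submission
  imports Defs
begin

section \<open>Protocols from decision trees\<close>

text \<open>Only the coordinator is modelled: \<open>Snd\<close> fixes a bit, while
  \<open>Rcv\<close> branches on a bit that the tree does not determine. The players enter later,
  through \<open>pbit\<close>.\<close>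

datatype ctree =
    Halt "nat set set"
  | Snd nat bool ctree
  | Rcv nat "bool \<Rightarrow> ctree"

fun descend :: "ctree \<Rightarrow> nat \<times> bool \<Rightarrow> ctree" where
  "descend (Halt H) _ = Halt H"
| "descend (Snd i b p) _ = p"
| "descend (Rcv i f) m = f (snd m)"

text \<open>The coordinator finds its node by replaying the transcript from the root. Stopping at
  channels outside \<open>{..<s}\<close> ensures \<open>has_players\<close>, which quantifies over
  all transcripts, including unreachable ones.\<close>

definition tree_protocol ::
  "nat \<Rightarrow> (bool list \<Rightarrow> bool) \<Rightarrow> (nat set set \<Rightarrow> bool list \<Rightarrow> bool) \<Rightarrow> ctree \<Rightarrow> protocol" where
  "tree_protocol s turn pbit p = \<lparr>
     coord_coins = return_pmf 0,
     player_coins = (\<lambda>_. return_pmf 0),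
     coord_turn = (\<lambda>_. turn),
     next_channel = (\<lambda>_ \<tau>. case foldl descend p \<tau> of
         Halt _ \<Rightarrow> None
       | Snd i _ _ \<Rightarrow> if i < s then Some i else None
       | Rcv i _ \<Rightarrow> if i < s then Some i else None),
     coord_bit = (\<lambda>_ \<tau>. case foldl descend p \<tau> of Snd _ b _ \<Rightarrow> b | _ \<Rightarrow> False),
     player_bit = (\<lambda>_ _. pbit),
     coord_output = (\<lambda>_ \<tau>. case foldl descend p \<tau> of Halt H \<Rightarrow> H | _ \<Rightarrow> {})\<rparr>"

text \<open>\<open>N\<close> is a budget rather than an exact length, so it can be enlarged freely.
  The \<open>turn\<close> premises force the tree to respect the speaking order, which depends on
  the channel history alone.\<close>

inductive runs ::
  "nat \<Rightarrow> (bool list \<Rightarrow> bool) \<Rightarrow> (nat set set \<Rightarrow> bool list \<Rightarrow> bool) \<Rightarrow> (nat \<Rightarrow> nat set set) \<Rightarrow>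
   (nat set set \<Rightarrow> bool) \<Rightarrow> nat \<Rightarrow> ctree \<Rightarrow> (nat \<Rightarrow> bool list) \<Rightarrow> bool"
  for s turn pbit X S where
  runs_Halt: "S H \<Longrightarrow> runs s turn pbit X S N (Halt H) h"
| runs_Snd: "i < s \<Longrightarrow> turn (h i) \<Longrightarrow> runs s turn pbit X S N p (h(i := h i @ [b])) \<Longrightarrow>
    runs s turn pbit X S (Suc N) (Snd i b p) h"
| runs_Rcv: "i < s \<Longrightarrow> \<not> turn (h i) \<Longrightarrow> b = pbit (X i) (h i) \<Longrightarrow>
    runs s turn pbit X S N (f b) (h(i := h i @ [b])) \<Longrightarrow>
    runs s turn pbit X S (Suc N) (Rcv i f) h"

lemma runs_mono:
  assumes "runs s turn pbit X S N p h" "N \<le> N'"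
  shows "runs s turn pbit X S N' p h"
  using assms
proof (induction arbitrary: N' rule: runs.induct)
  case (runs_Halt H N h)
  then show ?case by (auto intro: runs.intros)
next
  case (runs_Snd i h N p b)
  then obtain M where M: "N' = Suc M" "N \<le> M" by (cases N') auto
  show ?case
    unfolding M(1) by (rule runs.runs_Snd[OF runs_Snd.hyps(1,2) runs_Snd.IH[OF M(2)]])
next
  case (runs_Rcv i h b N f)
  then obtain M where M: "N' = Suc M" "N \<le> M" by (cases N') auto
  show ?case
    unfolding M(1)
    by (rule runs.runs_Rcv[of i s turn h b pbit X S M f,
          OF runs_Rcv.hyps(1-3) runs_Rcv.IH[OF M(2)]])
qed

lemma channel_snoc: "(\<lambda>j. channel j (\<tau> @ [(i, b)])) = (\<lambda>j. channel j \<tau>)(i := channel i \<tau> @ [b])"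
  by (auto simp: channel_def)

text \<open>The protocol keeps the root \<open>p\<close> while the induction descends; hence
  \<open>p'\<close> is described as the node reached after \<open>t\<close> bits.\<close>

lemma tree_protocol_halts:
  assumes "runs s turn pbit X S N p' h"
    and "foldl descend p (transcript (tree_protocol s turn pbit p) X \<omega> t) = p'"
    and "h = (\<lambda>i. channel i (transcript (tree_protocol s turn pbit p) X \<omega> t))"
  shows "\<exists>t'\<le>t + N. halted (tree_protocol s turn pbit p) X \<omega> t' \<and>
    S (coord_output (tree_protocol s turn pbit p) (fst \<omega>)
        (transcript (tree_protocol s turn pbit p) X \<omega> t'))"
  using assms
proof (induction arbitrary: t rule: runs.induct)
  case (runs_Halt H N h)
  then have "halted (tree_protocol s turn pbit p) X \<omega> t \<and>
    S (coord_output (tree_protocol s turn pbit p) (fst \<omega>)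
        (transcript (tree_protocol s turn pbit p) X \<omega> t))"
    by (simp add: halted_def tree_protocol_def)
  then show ?case by (intro exI[of _ t]) auto
next
  case (runs_Snd i h N p'' b)
  let ?P = "tree_protocol s turn pbit p"
  let ?\<tau> = "transcript ?P X \<omega> t"
  have eq: "transcript ?P X \<omega> (Suc t) = ?\<tau> @ [(i, b)]"
  proof -
    have "next_channel ?P (fst \<omega>) ?\<tau> = Some i"
      using runs_Snd by (simp add: tree_protocol_def)
    moreover have "next_bit ?P X \<omega> ?\<tau> i = b"
      using runs_Snd by (simp add: tree_protocol_def next_bit_def case_prod_unfold)
    ultimately show ?thesis by (simp add: Let_def)
  qed
  have "\<exists>t'\<le>Suc t + N. halted ?P X \<omega> t' \<and> S (coord_output ?P (fst \<omega>) (transcript ?P X \<omega> t'))"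
    using runs_Snd.prems by (intro runs_Snd.IH) (simp_all only: eq channel_snoc foldl_append, simp_all)
  then show ?case by simp
next
  case (runs_Rcv i h b N f)
  let ?P = "tree_protocol s turn pbit p"
  let ?\<tau> = "transcript ?P X \<omega> t"
  have eq: "transcript ?P X \<omega> (Suc t) = ?\<tau> @ [(i, b)]"
  proof -
    have "next_channel ?P (fst \<omega>) ?\<tau> = Some i"
      using runs_Rcv by (simp add: tree_protocol_def)
    moreover have "next_bit ?P X \<omega> ?\<tau> i = b"
      using runs_Rcv by (simp add: tree_protocol_def next_bit_def case_prod_unfold)
    ultimately show ?thesis by (simp add: Let_def)
  qed
  have "\<exists>t'\<le>Suc t + N. halted ?P X \<omega> t' \<and> S (coord_output ?P (fst \<omega>) (transcript ?P X \<omega> t'))"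
    using runs_Rcv.prems by (intro runs_Rcv.IH) (simp_all only: eq channel_snoc foldl_append, simp_all)
  then show ?case by simp
qed

text \<open>The run is good for every input whatever the coins are, so the success probability is 1
  and any \<open>\<pi> \<le> 1\<close> is met.\<close>

lemma tree_protocol_correct:
  assumes "\<And>X. X \<in> inputs n s \<Longrightarrow>
      runs s turn pbit X (is_spanner n \<alpha> (input_graph s X)) N p (\<lambda>_. [])"
    and "\<pi> \<le> 1"
  defines "P \<equiv> tree_protocol s turn pbit p"
  shows "computes_spanner n s \<alpha> \<pi> P" and "comm_cost n s P \<le> enat N"
proof -
  have halts: "\<exists>t'\<le>N. halted P X \<omega> t' \<and>
      is_spanner n \<alpha> (input_graph s X) (coord_output P (fst \<omega>) (transcript P X \<omega> t'))"
    if "X \<in> inputs n s" for X \<omega>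
    using tree_protocol_halts[OF assms(1)[OF that], of p \<omega> 0] by (simp add: P_def channel_def)
  have "has_players s P"
    by (auto simp: has_players_def P_def tree_protocol_def split: ctree.splits if_splits)
  moreover have "measure_pmf.prob (coins s P) {\<omega>. outputs_spanner n s \<alpha> P X \<omega>} = 1"
    if "X \<in> inputs n s" for X
  proof -
    have "{\<omega>. outputs_spanner n s \<alpha> P X \<omega>} = UNIV"
      using halts[OF that] by (auto simp: outputs_spanner_def)
    then show ?thesis by simp
  qed
  ultimately show "computes_spanner n s \<alpha> \<pi> P"
    using assms(2) by (simp add: computes_spanner_def)
  show "comm_cost n s P \<le> enat N"
    unfolding comm_cost_def
  proof (intro SUP_least)
    fix X \<omega> assume "X \<in> inputs n s"
    then obtain t where "t \<le> N" "halted P X \<omega> t" using halts by blast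
    then have "bits_exchanged P X \<omega> \<le> enat t"
      unfolding bits_exchanged_def by (intro INF_lower) auto
    also have "\<dots> \<le> enat N" using \<open>t \<le> N\<close> by simp
    finally show "bits_exchanged P X \<omega> \<le> enat N" .
  qed
qed

section \<open>Questions and answers of fixed length\<close>

primrec rcv :: "nat \<Rightarrow> nat \<Rightarrow> bool list \<Rightarrow> (bool list \<Rightarrow> ctree) \<Rightarrow> ctree" where
  "rcv i 0 acc f = f acc"
| "rcv i (Suc m) acc f = Rcv i (\<lambda>b. rcv i m (acc @ [b]) f)"

text \<open>Every channel carries frames: a question of \<open>L\<close> bits followed by an answer of \<open>L\<close> bits.
  A player keeps a state that is determined by the questions it has received.\<close>

locale framed =
  fixes L s :: nat
    and M :: "'m set"
    and enc :: "'m \<Rightarrow> bool list"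
    and dec :: "bool list \<Rightarrow> 'm"
    and upd :: "'m \<Rightarrow> 'st \<Rightarrow> 'st"
    and init :: 'st
    and answer :: "'st \<Rightarrow> 'm \<Rightarrow> nat set set \<Rightarrow> 'm"
  assumes L_pos: "L > 0"
    and length_enc: "m \<in> M \<Longrightarrow> length (enc m) = L"
    and dec_enc: "m \<in> M \<Longrightarrow> dec (enc m) = m"
begin

definition questions :: "bool list \<Rightarrow> 'm list" where
  "questions h = map (\<lambda>j. dec (take L (drop (j * (2 * L)) h))) [0..<length h div (2 * L)]"

definition state :: "bool list \<Rightarrow> 'st" where
  "state h = fold upd (questions h) init"

definition turn :: "bool list \<Rightarrow> bool" where
  "turn h \<longleftrightarrow> length h mod (2 * L) < L"

text \<open>\<open>f\<close> holds the complete frames and \<open>q\<close> the current one, of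
  which \<open>r - L\<close> answer bits have been sent already. The state comes from
  \<open>f\<close> alone, so a question is answered in the state before its own update.\<close>

definition pbit :: "nat set set \<Rightarrow> bool list \<Rightarrow> bool" where
  "pbit E h = (let r = length h mod (2 * L); f = take (length h - r) h; q = drop (length h - r) h
     in enc (answer (state f) (dec (take L q)) E) ! (r - L))"

definition ask :: "nat \<Rightarrow> 'm \<Rightarrow> ('m \<Rightarrow> ctree) \<Rightarrow> ctree" where
  "ask i q f = foldr (Snd i) (enc q) (rcv i L [] (\<lambda>w. f (dec w)))"

abbreviation "Runs \<equiv> runs s turn pbit"

lemma questions_append:
  assumes "length h mod (2 * L) = 0" "length a = L" "length b = L"
  shows "questions (h @ a @ b) = questions h @ [dec a]"
proof -
  obtain c where c: "length h = 2 * L * c" using assms(1) by auto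
  have len: "length (h @ a @ b) div (2 * L) = Suc c" "length h div (2 * L) = c"
    using c assms L_pos by (auto simp: div_add_self2 mult.commute)
  have "take L (drop (j * (2 * L)) (h @ a @ b)) = take L (drop (j * (2 * L)) h)" if "j < c" for j
  proof -
    have "Suc j * (2 * L) \<le> c * (2 * L)" using that by (intro mult_le_mono1) simp
    then have "j * (2 * L) + L \<le> length h" using c by (simp add: mult.commute)
    then show ?thesis by simp
  qed
  moreover have "take L (drop (c * (2 * L)) (h @ a @ b)) = a"
    using c assms by (simp add: mult.commute)
  ultimately show ?thesis
    unfolding questions_def len by (auto simp del: drop_append)
qed

text \<open>\<open>f\<close> consists of complete frames and \<open>pre\<close> of the question bits
  sent so far; the induction lets \<open>pre\<close> grow while \<open>f\<close> stays.\<close>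

lemma runs_question:
  assumes "i < s" "length f mod (2 * L) = 0" "h i = f @ pre" "length pre + length bs = L"
    and "Runs X S N p (h(i := f @ pre @ bs))"
  shows "Runs X S (length bs + N) (foldr (Snd i) bs p) h"
  using assms
proof (induction bs arbitrary: pre h)
  case Nil
  then have "h(i := f @ pre) = h" by auto
  with Nil show ?case by simp
next
  case (Cons b bs)
  have "turn (h i)"
  proof -
    have "length (h i) mod (2 * L) = length pre mod (2 * L)"
      using Cons.prems by (simp add: mod_add_eq[symmetric])
    then show ?thesis using Cons.prems by (simp add: turn_def)
  qed
  moreover have "Runs X S (length bs + N) (foldr (Snd i) bs p) (h(i := h i @ [b]))"
  proof (rule Cons.IH[of _ "pre @ [b]"])
    have "(h(i := h i @ [b]))(i := f @ (pre @ [b]) @ bs) = h(i := f @ pre @ b # bs)"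
      by simp
    then show "Runs X S N p ((h(i := h i @ [b]))(i := f @ (pre @ [b]) @ bs))"
      using Cons.prems(5) by (simp only:)
  qed (use Cons.prems in auto)
  ultimately show ?case
    using runs_Snd[of i s turn h pbit X S "length bs + N" _ b] Cons.prems(1) by simp
qed

text \<open>As the state is read off \<open>f\<close>, all answer bits belong to the same word
  \<open>w\<close>; \<open>acc\<close> is the part of it received so far.\<close>

lemma runs_answer:
  assumes "i < s" "length f mod (2 * L) = 0" "h i = f @ a @ acc" "length a = L"
    and "w = enc (answer (state f) (dec a) (X i))" "length w = L"
    and "acc = take (length acc) w" "length acc + m = L"
    and "Runs X S N (g w) (h(i := f @ a @ w))"
  shows "Runs X S (m + N) (rcv i m acc g) h"
  using assms
proof (induction m arbitrary: acc h)
  case 0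
  from 0(6-8) have "acc = w" by (metis add_0_right take_all_iff order_refl)
  with 0(3) have "h(i := f @ a @ w) = h" by (metis fun_upd_triv)
  with 0(9) \<open>acc = w\<close> show ?case by simp
next
  case (Suc m)
  let ?b = "w ! length acc"
  have r: "length (h i) mod (2 * L) = L + length acc"
  proof -
    obtain c where "length f = 2 * L * c" using Suc.prems(2) by auto
    then have "length (h i) = (L + length acc) + 2 * L * c"
      using Suc.prems(3,4) by simp
    then have "length (h i) mod (2 * L) = (L + length acc) mod (2 * L)"
      by (simp only: mod_mult_self2)
    then show ?thesis using Suc.prems(8) by simp
  qed
  have "pbit (X i) (h i) = ?b"
    unfolding pbit_def r using Suc.prems(3-6) by (simp add: Let_def)
  moreover have "\<not> turn (h i)" using r by (simp add: turn_def)
  moreover have "Runs X S (m + N) (rcv i m (acc @ [?b]) g) (h(i := h i @ [?b]))"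
  proof (rule Suc.IH[OF Suc.prems(1,2) _ Suc.prems(4-6)])
    have "length acc < length w" using Suc.prems(6,8) by simp
    then have "take (length (acc @ [?b])) w = take (length acc) w @ [?b]"
      by (simp add: take_Suc_conv_app_nth)
    then show "acc @ [?b] = take (length (acc @ [?b])) w"
      using Suc.prems(7) by simp
    show "Runs X S N (g w) ((h(i := h i @ [?b]))(i := f @ a @ w))"
      using Suc.prems(9) by (simp only: fun_upd_upd)
  qed (use Suc.prems(3,8) in auto)
  ultimately show ?case
    using runs_Rcv[of i s turn h ?b pbit X S "m + N"] Suc.prems(1) by simp
qed

text \<open>The continuation has to work for every \<open>h'\<close> that is aligned to frames and
  has the right state, so later arguments never see individual bits.\<close>

lemma runs_ask:
  assumes "i < s" "q \<in> M" "answer \<sigma> q (X i) \<in> M"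
    and "length (h i) mod (2 * L) = 0" "state (h i) = \<sigma>"
    and "\<And>h'. \<lbrakk>\<And>j. j \<noteq> i \<Longrightarrow> h' j = h j; length (h' i) mod (2 * L) = 0; state (h' i) = upd q \<sigma>\<rbrakk> \<Longrightarrow>
      Runs X S N (f (answer \<sigma> q (X i))) h'"
  shows "Runs X S (2 * L + N) (ask i q f) h"
proof -
  let ?w = "enc (answer \<sigma> q (X i))"
  let ?h = "h(i := h i @ enc q @ ?w)"
  have len: "length (enc q) = L" "length ?w = L"
    using assms length_enc by auto
  have "Runs X S N (f (answer \<sigma> q (X i))) ?h"
  proof (rule assms(6))
    have "length (?h i) = length (h i) + 2 * L" using len by simp
    then show "length (?h i) mod (2 * L) = 0" using assms(4) by simp
    show "state (?h i) = upd q \<sigma>"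
      using questions_append[OF assms(4) len] assms(2,5) by (simp add: state_def dec_enc)
  qed auto
  then have "Runs X S N (f (dec ?w)) ((h(i := h i @ [] @ enc q))(i := h i @ enc q @ ?w))"
    using assms(3) by (simp add: dec_enc)
  then have "Runs X S (L + N) (rcv i L [] (\<lambda>w. f (dec w))) (h(i := h i @ [] @ enc q))"
    by (intro runs_answer[where f = "h i" and a = "enc q" and w = ?w])
      (use assms len in \<open>auto simp: dec_enc\<close>)
  from runs_question[OF assms(1,4) _ _ this] show ?thesis
    using len by (simp add: ask_def mult_2 add.assoc)
qed

text \<open>Histories may differ between players, but questions to single players leave the state
  unchanged, so all players share the state \<open>\<sigma>\<close>.\<close>

definition okp ::
  "(nat \<Rightarrow> nat set set) \<Rightarrow> (nat set set \<Rightarrow> bool) \<Rightarrow> nat \<Rightarrow> ctree \<Rightarrow> 'st \<Rightarrow> bool" where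
  "okp X S N p \<sigma> \<longleftrightarrow>
     (\<forall>h. (\<forall>i<s. length (h i) mod (2 * L) = 0 \<and> state (h i) = \<sigma>) \<longrightarrow> Runs X S (2 * L * N) p h)"

lemma okp_mono: "okp X S N p \<sigma> \<Longrightarrow> N \<le> N' \<Longrightarrow> okp X S N' p \<sigma>"
  unfolding okp_def by (meson runs_mono mult_le_mono2)

lemma okp_Halt: "S H \<Longrightarrow> okp X S N (Halt H) \<sigma>"
  by (simp add: okp_def runs_Halt)

section \<open>Batches of questions and broadcasts, with costs counted in frames\<close>

primrec asks :: "(nat \<times> 'm) list \<Rightarrow> ('m list \<Rightarrow> ctree) \<Rightarrow> ctree" where
  "asks [] f = f []"
| "asks (iq # qs) f = ask (fst iq) (snd iq) (\<lambda>a. asks qs (\<lambda>as. f (a # as)))"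

text \<open>A question reaches one player only; \<open>upd q \<sigma> = \<sigma>\<close> keeps that
  player in step with the others.\<close>

lemma okp_asks:
  assumes "\<And>i q. (i, q) \<in> set qs \<Longrightarrow> i < s \<and> q \<in> M \<and> answer \<sigma> q (X i) \<in> M \<and> upd q \<sigma> = \<sigma>"
    and "okp X S N (f (map (\<lambda>(i, q). answer \<sigma> q (X i)) qs)) \<sigma>"
  shows "okp X S (length qs + N) (asks qs f) \<sigma>"
  using assms
proof (induction qs arbitrary: f)
  case Nil
  then show ?case by simp
next
  case (Cons iq qs)
  obtain i q where iq: "iq = (i, q)" by fastforce
  have prems: "i < s" "q \<in> M" "answer \<sigma> q (X i) \<in> M" "upd q \<sigma> = \<sigma>"
    using Cons.prems(1)[of i q] iq by auto
  have IH: "okp X S (length qs + N) (asks qs (\<lambda>as. f (answer \<sigma> q (X i) # as))) \<sigma>"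
    using Cons.prems iq by (intro Cons.IH) auto
  show ?case
    unfolding okp_def
  proof (intro allI impI)
    fix h assume h: "\<forall>i<s. length (h i) mod (2 * L) = 0 \<and> state (h i) = \<sigma>"
    have "Runs X S (2 * L + 2 * L * (length qs + N)) (asks (iq # qs) f) h"
      unfolding iq asks.simps fst_conv snd_conv
    proof (rule runs_ask[where \<sigma> = \<sigma>])
      fix h' assume "\<And>j. j \<noteq> i \<Longrightarrow> h' j = h j" "length (h' i) mod (2 * L) = 0"
        "state (h' i) = upd q \<sigma>"
      then have "\<forall>i<s. length (h' i) mod (2 * L) = 0 \<and> state (h' i) = \<sigma>"
        using h prems by metis
      then show "Runs X S (2 * L * (length qs + N)) (asks qs (\<lambda>as. f (answer \<sigma> q (X i) # as))) h'"
        using IH by (simp add: okp_def)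
    qed (use h prems in auto)
    then show "Runs X S (2 * L * (length (iq # qs) + N)) (asks (iq # qs) f) h"
      by (simp add: algebra_simps)
  qed
qed

definition bcast :: "'m \<Rightarrow> ctree \<Rightarrow> ctree" where
  "bcast m p = asks (map (\<lambda>i. (i, m)) [0..<s]) (\<lambda>_. p)"

lemma okp_bcast:
  assumes "m \<in> M" "\<And>i. i < s \<Longrightarrow> answer \<sigma> m (X i) \<in> M"
    and "okp X S N p (upd m \<sigma>)"
  shows "okp X S (s + N) (bcast m p) \<sigma>"
proof -
  \<comment> \<open>Amid a broadcast the players disagree: those in \<open>is\<close> are still
    waiting for \<open>m\<close>. The induction therefore tracks a mixed family of states, which is
    uniform at both ends.\<close>
  have "Runs X S (2 * L * (length is + N)) (asks (map (\<lambda>i. (i, m)) is) (\<lambda>_. p)) h"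
    if "distinct is" "set is \<subseteq> {..<s}"
      "\<forall>i<s. length (h i) mod (2 * L) = 0 \<and> state (h i) = (if i \<in> set is then \<sigma> else upd m \<sigma>)"
    for "is" h
    using that
  proof (induction "is" arbitrary: h)
    case Nil
    then show ?case using assms(3) by (simp add: okp_def)
  next
    case (Cons i "is")
    have "Runs X S (2 * L + 2 * L * (length is + N)) (asks (map (\<lambda>i. (i, m)) (i # is)) (\<lambda>_. p)) h"
      unfolding list.map asks.simps fst_conv snd_conv
    proof (rule runs_ask[where \<sigma> = \<sigma>])
      fix h' assume h': "\<And>j. j \<noteq> i \<Longrightarrow> h' j = h j" "length (h' i) mod (2 * L) = 0"
        "state (h' i) = upd m \<sigma>"
      have "\<forall>j<s. length (h' j) mod (2 * L) = 0 \<and>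
          state (h' j) = (if j \<in> set is then \<sigma> else upd m \<sigma>)"
      proof (intro allI impI)
        fix j assume "j < s"
        then show "length (h' j) mod (2 * L) = 0 \<and>
            state (h' j) = (if j \<in> set is then \<sigma> else upd m \<sigma>)"
          using Cons.prems h' by (cases "j = i") auto
      qed
      then show "Runs X S (2 * L * (length is + N)) (asks (map (\<lambda>i. (i, m)) is) (\<lambda>_. p)) h'"
        using Cons.prems by (intro Cons.IH) auto
    qed (use Cons.prems assms in auto)
    then show ?case by (simp add: algebra_simps)
  qed
  from this[of "[0..<s]"] show ?thesis
    by (simp add: okp_def bcast_def atLeast_upt)
qed

lemma okp_bcasts:
  assumes "\<And>m. m \<in> set ms \<Longrightarrow> m \<in> M"
    and "\<And>m \<sigma> i. m \<in> set ms \<Longrightarrow> i < s \<Longrightarrow> answer \<sigma> m (X i) \<in> M"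
    and "okp X S N p (fold upd ms \<sigma>)"
  shows "okp X S (s * length ms + N) (foldr bcast ms p) \<sigma>"
  using assms
proof (induction ms arbitrary: \<sigma>)
  case Nil
  then show ?case by simp
next
  case (Cons m ms)
  have "okp X S (s + (s * length ms + N)) (bcast m (foldr bcast ms p)) \<sigma>"
    using Cons.prems by (intro okp_bcast Cons.IH) auto
  then show ?case by (simp add: algebra_simps)
qed

lemma okp_runs:
  assumes "okp X S N p init"
  shows "Runs X S (2 * L * N) p (\<lambda>_. [])"
  using assms by (simp add: okp_def state_def questions_def)

end

section \<open>Distances\<close>

text \<open>Walks that may pause: exact length \<open>l\<close> then expresses distance at most
  \<open>l\<close>, without infima and without \<open>\<infinity>\<close>.\<close>

definition near :: "nat set set \<Rightarrow> nat \<Rightarrow> nat \<Rightarrow> nat \<Rightarrow> bool" where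
  "near H l u v \<longleftrightarrow> (u, v) \<in> {(x, y). x = y \<or> {x, y} \<in> H} ^^ l"

lemma near_refl: "near H l u u"
  by (induction l) (auto simp: near_def)

lemma near_edge: "{u, v} \<in> H \<Longrightarrow> near H (Suc 0) u v"
  by (simp add: near_def)

lemma near_trans: "near H l u v \<Longrightarrow> near H l' v w \<Longrightarrow> near H (l + l') u w"
  by (auto simp: near_def relpow_add)

lemma near_le: "near H l u v \<Longrightarrow> l \<le> l' \<Longrightarrow> near H l' u v"
  using near_trans[of H l u v "l' - l" v] near_refl by simp

lemma near_mono:
  assumes "near H l u v" "H \<subseteq> H'"
  shows "near H' l u v"
proof -
  have "{(x, y). x = y \<or> {x, y} \<in> H} ^^ l \<subseteq> {(x, y). x = y \<or> {x, y} \<in> H'} ^^ l"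
    using assms(2) by (induction l) (auto simp: relcomp_mono)
  then show ?thesis using assms(1) by (auto simp: near_def)
qed

lemma near_sym: "near H l u v \<Longrightarrow> near H l v u"
proof (induction l arbitrary: v)
  case 0
  then show ?case by (simp add: near_def)
next
  case (Suc l)
  then obtain w where w: "near H l u w" "w = v \<or> {w, v} \<in> H" by (auto simp: near_def)
  then have "near H (Suc 0) v w" by (auto simp: near_def insert_commute)
  from near_trans[OF this Suc.IH[OF w(1)]] show ?case by simp
qed

lemma near_walk:
  assumes "near H l u v"
  shows "\<exists>l'\<le>l. (u, v) \<in> {(x, y). {x, y} \<in> H} ^^ l'"
  using assms
proof (induction l arbitrary: v)
  case 0
  then show ?case by (simp add: near_def)
next
  case (Suc l)
  then obtain w where w: "near H l u w" "w = v \<or> {w, v} \<in> H" by (auto simp: near_def)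
  from Suc.IH[OF w(1)] obtain l' where l': "l' \<le> l" "(u, w) \<in> {(x, y). {x, y} \<in> H} ^^ l'"
    by blast
  from w(2) show ?case
  proof
    assume "w = v"
    with l' show ?thesis by (auto intro: exI[of _ l'])
  next
    assume "{w, v} \<in> H"
    then have "(u, v) \<in> {(x, y). {x, y} \<in> H} ^^ Suc l'" using l'(2) by auto
    with l'(1) show ?thesis by (meson Suc_le_mono)
  qed
qed

text \<open>A shortest walk in \<open>E\<close> is replaced edge by edge by walks in
  \<open>H\<close> of length at most \<open>\<alpha>\<close>.\<close>

lemma is_spannerI:
  assumes "H \<subseteq> E" "\<alpha> > 0" and edge: "\<And>u v. {u, v} \<in> E \<Longrightarrow> near H \<alpha> u v"
  shows "is_spanner n \<alpha> E H"
proof -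
  have "gdist H u v \<le> enat \<alpha> * gdist E u v" for u v
  proof (cases "{l. (u, v) \<in> {(x, y). {x, y} \<in> E} ^^ l} = {}")
    case True
    then have "gdist E u v = \<infinity>" unfolding gdist_def by (simp add: top_enat_def)
    \<comment> \<open>Positivity of \<open>\<alpha>\<close> enters because
      \<open>0 * \<infinity> = 0\<close> in \<open>enat\<close>.\<close>
    then show ?thesis using assms(2) by (simp add: enat_0_iff)
  next
    case False
    then obtain l0 where "enat l0 \<in> enat ` {l. (u, v) \<in> {(x, y). {x, y} \<in> E} ^^ l}" by blast
    then have "gdist E u v \<in> enat ` {l. (u, v) \<in> {(x, y). {x, y} \<in> E} ^^ l}"
      unfolding gdist_def by (rule wellorder_InfI)
    then obtain l where l: "gdist E u v = enat l" "(u, v) \<in> {(x, y). {x, y} \<in> E} ^^ l" by auto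
    have "near H (\<alpha> * l) u v"
      using l(2)
    proof (induction l arbitrary: v)
      case 0
      then show ?case by (simp add: near_def)
    next
      case (Suc l)
      then obtain w where "(u, w) \<in> {(x, y). {x, y} \<in> E} ^^ l" "{w, v} \<in> E" by auto
      from near_trans[OF Suc.IH[OF this(1)] edge[OF this(2)]] show ?case
        by (simp add: add.commute)
    qed
    then obtain l' where l': "l' \<le> \<alpha> * l" "(u, v) \<in> {(x, y). {x, y} \<in> H} ^^ l'"
      using near_walk by blast
    then have "gdist H u v \<le> enat l'" unfolding gdist_def by (intro INF_lower) auto
    also have "\<dots> \<le> enat \<alpha> * enat l" using l'(1) by simp
    finally show ?thesis using l(1) by simp
  qed
  then show ?thesis using assms(1) by (simp add: is_spanner_def)
qed

section \<open>The clustering algorithm\<close>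

text \<open>A state \<open>(cl, nw)\<close> consists of two partial clusterings, given as maps from the vertices to
  the centers: the last complete one, and the one that is currently built.\<close>

type_synonym clusterings = "(nat \<Rightarrow> nat option) \<times> (nat \<Rightarrow> nat option)"

text \<open>\<open>Count\<close>, \<open>Item\<close> and \<open>Link\<close> are asked of single
  players, \<open>Next\<close> and \<open>Capture\<close> are broadcast, and the rest are answers.
  One type for all of them allows one code of fixed length.\<close>

datatype msg =
    Count nat | Item nat nat | Link nat nat
  | Next | Capture nat nat
  | Number nat | Edge nat nat | Nothing

fun upd :: "msg \<Rightarrow> clusterings \<Rightarrow> clusterings" where
  "upd Next \<sigma> = (snd \<sigma>, Map.empty)"
| "upd (Capture u z) \<sigma> = (fst \<sigma>, (snd \<sigma>)(u \<mapsto> z))"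
| "upd _ \<sigma> = \<sigma>"

definition joinable :: "clusterings \<Rightarrow> nat \<Rightarrow> nat set set \<Rightarrow> nat set" where
  "joinable \<sigma> z E = {u. snd \<sigma> u = None \<and> (\<exists>v. {u, v} \<in> E \<and> fst \<sigma> v = Some z)}"

definition contact :: "clusterings \<Rightarrow> nat \<Rightarrow> nat set set \<Rightarrow> nat \<Rightarrow> nat" where
  "contact \<sigma> z E u = (SOME v. {u, v} \<in> E \<and> fst \<sigma> v = Some z)"

text \<open>In the last phase the clusterings of levels \<open>i\<close> and \<open>j = k div 2\<close> with \<open>i + j = k - 1\<close> are
  linked, so \<open>i = j - 1\<close> for even \<open>k\<close> and \<open>i = j\<close> for odd \<open>k\<close>.\<close>

definition side :: "nat \<Rightarrow> clusterings \<Rightarrow> nat \<Rightarrow> nat option" where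
  "side k \<sigma> = (if even k then fst \<sigma> else snd \<sigma>)"

definition links :: "nat \<Rightarrow> clusterings \<Rightarrow> nat \<Rightarrow> nat \<Rightarrow> nat set set \<Rightarrow> (nat \<times> nat) set" where
  "links k \<sigma> a b E = {(u, v). {u, v} \<in> E \<and> side k \<sigma> u = Some a \<and> snd \<sigma> v = Some b}"

fun answer :: "nat \<Rightarrow> clusterings \<Rightarrow> msg \<Rightarrow> nat set set \<Rightarrow> msg" where
  "answer k \<sigma> (Count z) E = Number (card (joinable \<sigma> z E))"
| "answer k \<sigma> (Item z j) E =
     (let u = sorted_list_of_set (joinable \<sigma> z E) ! j in Edge u (contact \<sigma> z E u))"
| "answer k \<sigma> (Link a b) E =
     (if links k \<sigma> a b E = {} then Nothing
      else case SOME e. e \<in> links k \<sigma> a b E of (u, v) \<Rightarrow> Edge u v)"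
| "answer k \<sigma> _ E = Nothing"

fun bounded :: "nat \<Rightarrow> msg \<Rightarrow> bool" where
  "bounded n (Count z) \<longleftrightarrow> z \<le> n"
| "bounded n (Item z j) \<longleftrightarrow> z \<le> n \<and> j \<le> n"
| "bounded n (Link a b) \<longleftrightarrow> a \<le> n \<and> b \<le> n"
| "bounded n Next \<longleftrightarrow> True"
| "bounded n (Capture u z) \<longleftrightarrow> u \<le> n \<and> z \<le> n"
| "bounded n (Number c) \<longleftrightarrow> c \<le> n"
| "bounded n (Edge u v) \<longleftrightarrow> u \<le> n \<and> v \<le> n"
| "bounded n Nothing \<longleftrightarrow> True"

fun number :: "msg \<Rightarrow> nat" where
  "number (Number c) = c"
| "number _ = 0"

fun source :: "msg \<Rightarrow> nat" where
  "source (Edge u v) = u"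
| "source _ = 0"

definition edges_of :: "msg list \<Rightarrow> nat set set" where
  "edges_of es = {{u, v} | u v. Edge u v \<in> set es}"

definition ident :: "nat \<Rightarrow> nat \<Rightarrow> nat option" where
  "ident n v = (if v < n then Some v else None)"

lemma all_edgesD: "{u, v} \<in> all_edges n \<Longrightarrow> u < n \<and> v < n \<and> u \<noteq> v"
  by (auto simp: all_edges_def card_insert_if split: if_splits)

lemma fold_upd_Capture:
  "fold upd (map (\<lambda>u. Capture u z) us) \<sigma> =
     (fst \<sigma>, \<lambda>u. if u \<in> set us then Some z else snd \<sigma> u)"
  by (induction us arbitrary: \<sigma>) (auto simp: fun_eq_iff)

text \<open>\<open>q\<close> is the rate at which the clusterings shrink; \<open>q_power\<close>
  makes it large enough for the linking phase to stay within the budget of one level.\<close>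

locale clustering = framed L s "Collect (bounded n)" enc dec upd "(ident n, ident n)" "answer k"
  for L s n k :: nat and enc dec +
  fixes q :: real
  assumes q_ge_1: "q \<ge> 1" and s_pos: "s > 0" and s_le: "s \<le> n" and k_ge_3: "k \<ge> 3"
    and q_power: "real n \<le> (real s)\<^sup>2 * q ^ k"
begin

text \<open>Counting first lets every offered edge travel in its own frame. Several players may
  offer the same vertex, hence \<open>remdups\<close>. Offers below the threshold still contribute
  their edges to the spanner.\<close>

primrec scan ::
  "nat \<Rightarrow> (clusterings \<Rightarrow> nat set set \<Rightarrow> ctree) \<Rightarrow> nat list \<Rightarrow> clusterings \<Rightarrow> nat set set \<Rightarrow> ctree"
where
  "scan T f [] \<sigma> H = f \<sigma> H"
| "scan T f (z # zs) \<sigma> H = asks (map (\<lambda>i. (i, Count z)) [0..<s]) (\<lambda>cs.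
     asks (concat (map (\<lambda>i. map (\<lambda>j. (i, Item z j)) [0..<number (cs ! i)]) [0..<s])) (\<lambda>es.
       let ms = if T \<le> length es then map (\<lambda>u. Capture u z) (remdups (map source es)) else []
       in foldr bcast ms (scan T f zs (fold upd ms \<sigma>) (H \<union> edges_of es))))"

definition level_cost :: nat where
  "level_cost = nat \<lfloor>6 * real s * real n * q\<rfloor>"

text \<open>With \<open>m\<close> centers, those that stay below the threshold offer at most about
  \<open>s * n * q\<close> edges altogether.\<close>

definition threshold :: "nat \<Rightarrow> nat" where
  "threshold m = nat \<lceil>real s * real n * q / real m\<rceil>"

primrec levels ::
  "nat \<Rightarrow> (clusterings \<Rightarrow> nat set set \<Rightarrow> ctree) \<Rightarrow> clusterings \<Rightarrow> nat set set \<Rightarrow> ctree"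
where
  "levels 0 f \<sigma> H = f \<sigma> H"
| "levels (Suc m) f \<sigma> H = bcast Next
     (scan (threshold (card (ran (snd \<sigma>)))) (levels m f)
        (sorted_list_of_set (ran (snd \<sigma>))) (upd Next \<sigma>) H)"

definition link :: "clusterings \<Rightarrow> nat set set \<Rightarrow> ctree" where
  "link \<sigma> H = asks
     (map (\<lambda>(i, a, b). (i, Link a b))
       (List.product [0..<s] (List.product (sorted_list_of_set (ran (side k \<sigma>)))
         (sorted_list_of_set (ran (snd \<sigma>))))))
     (\<lambda>es. Halt (H \<union> edges_of es))"

text \<open>The first component is a placeholder: the initial \<open>Next\<close> overwrites it with
  the second one, the clustering into singletons.\<close>

definition spanner_tree :: ctree where
  "spanner_tree = levels (k div 2) link (ident n, ident n) {}"

end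

section \<open>Edges offered to a center\<close>

locale clustering_input = clustering +
  fixes X :: "nat \<Rightarrow> nat set set"
  assumes X: "X \<in> inputs n s"
begin

abbreviation "E \<equiv> input_graph s X"

definition offers :: "clusterings \<Rightarrow> nat \<Rightarrow> (nat \<times> nat) list" where
  "offers \<sigma> z =
     concat (map (\<lambda>i. map (Pair i) (sorted_list_of_set (joinable \<sigma> z (X i)))) [0..<s])"

definition collected :: "clusterings \<Rightarrow> nat \<Rightarrow> msg list" where
  "collected \<sigma> z = map (\<lambda>(i, u). Edge u (contact \<sigma> z (X i) u)) (offers \<sigma> z)"

lemma X_edge: "i < s \<Longrightarrow> {u, v} \<in> X i \<Longrightarrow> u < n \<and> v < n \<and> u \<noteq> v"
  using X unfolding inputs_def by (intro all_edgesD) blast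

lemma E_edge: "{u, v} \<in> E \<Longrightarrow> u < n \<and> v < n \<and> u \<noteq> v"
  unfolding input_graph_def UN_iff by (blast dest: X_edge)

lemma joinable_subset: "i < s \<Longrightarrow> joinable \<sigma> z (X i) \<subseteq> {..<n}"
  unfolding joinable_def by (blast dest: X_edge)

lemma finite_joinable: "i < s \<Longrightarrow> finite (joinable \<sigma> z (X i))"
  by (rule finite_subset[OF joinable_subset]) simp_all

lemma card_joinable: "i < s \<Longrightarrow> card (joinable \<sigma> z (X i)) \<le> n"
  using card_mono[OF finite_lessThan joinable_subset[of i \<sigma> z]] by simp

lemma set_offers: "set (offers \<sigma> z) = Sigma {..<s} (\<lambda>i. joinable \<sigma> z (X i))"
proof -
  have "set (map (Pair i) (sorted_list_of_set (joinable \<sigma> z (X i)))) = Pair i ` joinable \<sigma> z (X i)"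
    if "i \<in> set [0..<s]" for i
    using that finite_joinable[of i \<sigma> z] by simp
  then have "set (offers \<sigma> z) = (\<Union>i\<in>set [0..<s]. Pair i ` joinable \<sigma> z (X i))"
    unfolding offers_def set_concat set_map image_image by (rule SUP_cong[OF refl])
  then show ?thesis by auto
qed

lemma distinct_offers: "distinct (offers \<sigma> z)"
proof (rule card_distinct)
  have "length (offers \<sigma> z) = (\<Sum>i\<leftarrow>[0..<s]. card (joinable \<sigma> z (X i)))"
    by (simp add: offers_def length_concat comp_def)
  then show "card (set (offers \<sigma> z)) = length (offers \<sigma> z)"
    using finite_joinable
    by (simp add: set_offers card_SigmaI interv_sum_list_conv_sum_set_nat lessThan_atLeast0)
qed

lemma contact:
  assumes "u \<in> joinable \<sigma> z F"
  shows "{u, contact \<sigma> z F u} \<in> F" "fst \<sigma> (contact \<sigma> z F u) = Some z"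
proof -
  have "{u, contact \<sigma> z F u} \<in> F \<and> fst \<sigma> (contact \<sigma> z F u) = Some z"
    unfolding contact_def by (rule someI_ex) (use assms in \<open>auto simp: joinable_def\<close>)
  then show "{u, contact \<sigma> z F u} \<in> F" "fst \<sigma> (contact \<sigma> z F u) = Some z" by auto
qed

lemma collectedD:
  assumes "e \<in> set (collected \<sigma> z)"
  shows "\<exists>u v. e = Edge u v \<and> {u, v} \<in> E \<and> snd \<sigma> u = None \<and> fst \<sigma> v = Some z"
proof -
  obtain i u where *: "(i, u) \<in> set (offers \<sigma> z)" "e = Edge u (contact \<sigma> z (X i) u)"
    using assms by (auto simp: collected_def)
  then have "i < s" "u \<in> joinable \<sigma> z (X i)" by (auto simp: set_offers)
  with * contact[of u \<sigma> z "X i"] show ?thesis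
    by (auto simp: input_graph_def joinable_def)
qed

lemma collected_complete:
  assumes "{u, v} \<in> E" "snd \<sigma> u = None" "fst \<sigma> v = Some z"
  shows "\<exists>w. Edge u w \<in> set (collected \<sigma> z)"
proof -
  obtain i where "i < s" "{u, v} \<in> X i" using assms(1) by (auto simp: input_graph_def)
  then have "(i, u) \<in> set (offers \<sigma> z)" using assms by (auto simp: set_offers joinable_def)
  then show ?thesis by (force simp: collected_def)
qed

text \<open>Each player offers a vertex at most once. If the cluster is just \<open>z\<close>, an
  offer of \<open>u\<close> is the edge \<open>{u, z}\<close> itself, and disjointness of the inputs
  leaves a single player holding it; this saves the factor \<open>s\<close> on the first
  level.\<close>

lemma length_collected:
  shows "length (collected \<sigma> z) \<le> s * card (source ` set (collected \<sigma> z))"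
    and "(\<And>v. fst \<sigma> v = Some z \<Longrightarrow> v = z) \<Longrightarrow>
      length (collected \<sigma> z) \<le> card (source ` set (collected \<sigma> z))"
proof -
  let ?O = "set (offers \<sigma> z)"
  have src: "source ` set (collected \<sigma> z) = snd ` ?O"
    by (force simp: collected_def)
  have card: "card ?O = length (collected \<sigma> z)"
    using distinct_offers[of \<sigma> z] by (simp add: collected_def distinct_card)
  have "?O \<subseteq> {..<s} \<times> snd ` ?O" unfolding set_offers by force
  from card_mono[OF _ this] show "length (collected \<sigma> z) \<le> s * card (source ` set (collected \<sigma> z))"
    by (simp add: card card_cartesian_product src)
  assume single: "\<And>v. fst \<sigma> v = Some z \<Longrightarrow> v = z"
  have "inj_on snd ?O"
  proof (rule inj_onI)
    fix x y assume xy: "x \<in> ?O" "y \<in> ?O" "snd x = snd y"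
    then have "{snd x, z} \<in> X (fst x)" "{snd x, z} \<in> X (fst y)" "fst x < s" "fst y < s"
      using single by (fastforce simp: joinable_def set_offers)+
    moreover have "disjoint_family_on X {..<s}" using X by (simp add: inputs_def)
    ultimately have "fst x = fst y" by (auto simp: disjoint_family_on_def)
    with xy show "x = y" by (simp add: prod_eq_iff)
  qed
  then show "length (collected \<sigma> z) \<le> card (source ` set (collected \<sigma> z))"
    by (simp add: src card_image card)
qed

section \<open>Cost and invariant of a scan over the centers\<close>

lemma okp_scan_Cons:
  fixes T z :: nat and \<sigma> :: clusterings
  defines "es \<equiv> collected \<sigma> z"
  defines "us \<equiv> if T \<le> length es then source ` set es else {}"
  defines "\<sigma>' \<equiv> (fst \<sigma>, \<lambda>u. if u \<in> us then Some z else snd \<sigma> u)"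
  assumes "z < n" and ok: "okp X S N (scan T f zs \<sigma>' (H \<union> edges_of es)) \<sigma>'"
  shows "okp X S (s + T + 2 * s * card us + N) (scan T f (z # zs) \<sigma> H) \<sigma>"
proof -
  let ?c = "\<lambda>i. card (joinable \<sigma> z (X i))"
  let ?qs = "concat (map (\<lambda>i. map (\<lambda>j. (i, Item z j)) [0..<?c i]) [0..<s])"
  let ?ms = "if T \<le> length es then map (\<lambda>u. Capture u z) (remdups (map source es)) else []"
  have ms: "fold upd ?ms \<sigma> = \<sigma>'" "length ?ms = card us"
    by (auto simp: \<sigma>'_def us_def fold_upd_Capture length_remdups_card_conv)
  have us: "us \<subseteq> {..<n}"
  proof
    fix u assume "u \<in> us"
    then obtain e where "e \<in> set (collected \<sigma> z)" "u = source e"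
      by (auto simp: us_def es_def split: if_splits)
    then show "u \<in> {..<n}" using collectedD[of e \<sigma> z] E_edge by auto
  qed
  have bc: "okp X S (s * card us + N)
      (foldr bcast ?ms (scan T f zs (fold upd ?ms \<sigma>) (H \<union> edges_of es))) \<sigma>"
    unfolding ms(2)[symmetric]
  proof (rule okp_bcasts)
    show "m \<in> Collect (bounded n)" "answer k \<sigma>'' m (X i) \<in> Collect (bounded n)"
      if "m \<in> set ?ms" for m \<sigma>'' i
      using that us \<open>z < n\<close> by (auto simp: us_def split: if_splits)
    show "okp X S N (scan T f zs (fold upd ?ms \<sigma>) (H \<union> edges_of es)) (fold upd ?ms \<sigma>)"
      unfolding ms(1) by (rule ok)
  qed
  \<comment> \<open>Reading the sorted lists by index yields the offers in the order of
    \<open>collected\<close>.\<close>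
  have answers: "map (\<lambda>(i, q). answer k \<sigma> q (X i)) ?qs = es"
  proof -
    have "map (\<lambda>j. (case (i, Item z j) of (i, q) \<Rightarrow> answer k \<sigma> q (X i))) [0..<?c i] =
        map (\<lambda>u. case (i, u) of (i, u) \<Rightarrow> Edge u (contact \<sigma> z (X i) u))
          (sorted_list_of_set (joinable \<sigma> z (X i)))" for i
      by (rule nth_equalityI) (auto simp: Let_def)
    then show ?thesis
      unfolding es_def collected_def offers_def
      by (simp add: map_concat comp_def case_prod_unfold)
  qed
  define cont where "cont = (\<lambda>es.
      let ms = if T \<le> length es then map (\<lambda>u. Capture u z) (remdups (map source es)) else []
      in foldr bcast ms (scan T f zs (fold upd ms \<sigma>) (H \<union> edges_of es)))"
  have "okp X S (length ?qs + (s * card us + N)) (asks ?qs cont) \<sigma>"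
  proof (rule okp_asks)
    fix i q assume "(i, q) \<in> set ?qs"
    then obtain j where j: "q = Item z j" "i < s" "j < ?c i" by auto
    let ?u = "sorted_list_of_set (joinable \<sigma> z (X i)) ! j"
    have "?u \<in> joinable \<sigma> z (X i)"
      using j finite_joinable[of i \<sigma> z] nth_mem[of j "sorted_list_of_set (joinable \<sigma> z (X i))"]
      by simp
    then have "{?u, contact \<sigma> z (X i) ?u} \<in> X i" by (rule contact)
    then show "i < s \<and> q \<in> Collect (bounded n) \<and> answer k \<sigma> q (X i) \<in> Collect (bounded n) \<and>
        upd q \<sigma> = \<sigma>"
      using j \<open>z < n\<close> card_joinable[of i \<sigma> z] X_edge[of i] by (auto simp: Let_def less_imp_le)
  next
    show "okp X S (s * card us + N) (cont (map (\<lambda>(i, q). answer k \<sigma> q (X i)) ?qs)) \<sigma>"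
      unfolding answers cont_def Let_def by (rule bc)
  qed
  \<comment> \<open>Below the threshold there are fewer than \<open>T\<close> offers; otherwise
    every offered vertex is captured, and each was offered at most \<open>s\<close> times.\<close>
  moreover have "length ?qs \<le> T + s * card us"
  proof -
    have "length ?qs = length es" using arg_cong[OF answers, of length] by (simp only: length_map)
    then show ?thesis using length_collected(1)[of \<sigma> z] by (auto simp: us_def es_def)
  qed
  ultimately have ok': "okp X S (T + (2 * s * card us + N)) (asks ?qs cont) \<sigma>"
    by (elim okp_mono) simp
  let ?cs = "map (\<lambda>(i, q). answer k \<sigma> q (X i)) (map (\<lambda>i. (i, Count z)) [0..<s])"
  have "concat (map (\<lambda>i. map (\<lambda>j. (i, Item z j)) [0..<number (?cs ! i)]) [0..<s])
      = concat (map (\<lambda>i. map (\<lambda>j. (i, Item z j)) [0..<?c i]) [0..<s])"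
    by (intro arg_cong[of _ _ concat] map_cong) auto
  with ok' have ok'': "okp X S (T + (2 * s * card us + N)) (asks (concat
      (map (\<lambda>i. map (\<lambda>j. (i, Item z j)) [0..<number (?cs ! i)]) [0..<s])) cont) \<sigma>"
    by (simp only:)
  have "okp X S (length (map (\<lambda>i. (i, Count z)) [0..<s]) + (T + (2 * s * card us + N)))
      (scan T f (z # zs) \<sigma> H) \<sigma>"
    unfolding scan.simps cont_def[symmetric]
  proof (rule okp_asks)
    fix i q assume "(i, q) \<in> set (map (\<lambda>i. (i, Count z)) [0..<s])"
    then show "i < s \<and> q \<in> Collect (bounded n) \<and> answer k \<sigma> q (X i) \<in> Collect (bounded n) \<and>
        upd q \<sigma> = \<sigma>"
      using \<open>z < n\<close> card_joinable[of _ \<sigma> z] by auto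
  qed (rule ok'')
  then show ?thesis by (simp add: add.assoc)
qed

text \<open>\<open>Z\<close> contains the visited centers, and \<open>g\<close> bounds the offers
  per vertex. The last conjunct lets each new cluster charge \<open>T\<close> offers to the vertices
  it captured.\<close>

definition scan_inv ::
  "nat \<Rightarrow> nat \<Rightarrow> nat \<Rightarrow> nat set \<Rightarrow> clusterings \<Rightarrow> nat set set \<Rightarrow> bool" where
  "scan_inv r g T Z \<sigma> H \<longleftrightarrow> H \<subseteq> E \<and>
     (\<forall>u z. fst \<sigma> u = Some z \<longrightarrow> z < n \<and> near H r u z) \<and>
     (\<forall>u z. snd \<sigma> u = Some z \<longrightarrow> u < n \<and> z \<in> Z \<and> near H (Suc r) u z) \<and>
     (\<forall>u v z. {u, v} \<in> E \<and> fst \<sigma> v = Some z \<and> z \<in> Z \<and> snd \<sigma> u = None \<longrightarrow>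
        near H (2 * r + 1) u v) \<and>
     card (ran (snd \<sigma>)) * T \<le> g * card (dom (snd \<sigma>))"

lemma edges_of_collected: "edges_of (collected \<sigma> z) \<subseteq> E"
  by (auto simp: edges_of_def dest!: collectedD)

lemma finite_dom_ran:
  assumes "dom f \<subseteq> {..<n}"
  shows "finite (dom f)" "finite (ran f)" "card (dom f) \<le> n"
proof -
  show "finite (dom f)" by (rule finite_subset[OF assms]) simp
  then show "finite (ran f)" by (rule finite_ran)
  show "card (dom f) \<le> n" using card_mono[OF _ assms] by simp
qed

text \<open>A captured vertex reaches \<open>z\<close> through an offered edge, which raises the
  radius by one. A vertex that is offered but not captured keeps one edge into the cluster of
  \<open>z\<close>, and this edge spans all its other edges into that cluster.\<close>

lemma scan_inv_step:
  fixes T z :: nat and \<sigma> :: clusterings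
  defines "es \<equiv> collected \<sigma> z"
  defines "us \<equiv> if T \<le> length es then source ` set es else {}"
  defines "\<sigma>' \<equiv> (fst \<sigma>, \<lambda>u. if u \<in> us then Some z else snd \<sigma> u)"
  assumes inv: "scan_inv r g T Z \<sigma> H" and z: "z < n"
    and g: "g = s \<or> g = 1 \<and> (\<forall>u y. fst \<sigma> u = Some y \<longrightarrow> u = y)"
  shows "scan_inv r g T (insert z Z) \<sigma>' (H \<union> edges_of es)"
    and "card (dom (snd \<sigma>')) = card (dom (snd \<sigma>)) + card us"
proof -
  let ?H = "H \<union> edges_of es"
  have old: "near ?H l u v" if "near H l u v" for l u v
    using that by (rule near_mono) simp
  have HE: "H \<subseteq> E" using inv by (simp add: scan_inv_def)
  have cl: "z < n \<and> near ?H r u z" if "fst \<sigma> u = Some z" for u z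
    using inv that old by (simp add: scan_inv_def)
  have nw: "u < n \<and> z \<in> Z \<and> near ?H (Suc r) u z" if "snd \<sigma> u = Some z" for u z
    using inv that old by (simp add: scan_inv_def)
  have spanned: "near ?H (2 * r + 1) u v"
    if "{u, v} \<in> E" "fst \<sigma> v = Some y" "y \<in> Z" "snd \<sigma> u = None" for u v y
    using inv that old unfolding scan_inv_def by blast
  have card: "card (ran (snd \<sigma>)) * T \<le> g * card (dom (snd \<sigma>))"
    using inv by (simp add: scan_inv_def)
  have new: "\<exists>v. {u, v} \<in> E \<and> {u, v} \<in> ?H \<and> snd \<sigma> u = None \<and> fst \<sigma> v = Some z"
    if "u \<in> source ` set es" for u
  proof -
    obtain e where e: "e \<in> set es" "u = source e" using \<open>u \<in> source ` set es\<close> by blast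
    from collectedD[OF e(1)[unfolded es_def]] obtain v
      where "e = Edge u v" "{u, v} \<in> E" "snd \<sigma> u = None" "fst \<sigma> v = Some z"
      using e(2) by auto
    with e(1) show ?thesis by (auto simp: edges_of_def)
  qed
  have new_us: "\<exists>v. {u, v} \<in> E \<and> {u, v} \<in> ?H \<and> snd \<sigma> u = None \<and> fst \<sigma> v = Some z"
    if "u \<in> us" for u
    using new[of u] that by (simp add: us_def split: if_splits)
  have "finite us" by (simp add: us_def)
  have dom: "dom (snd \<sigma>) \<subseteq> {..<n}" using nw by auto
  have disj: "dom (snd \<sigma>) \<inter> us = {}" using new_us by fastforce
  have dom': "dom (snd \<sigma>') = dom (snd \<sigma>) \<union> us" by (auto simp: \<sigma>'_def dom_def)
  show card_dom: "card (dom (snd \<sigma>')) = card (dom (snd \<sigma>)) + card us"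
    unfolding dom' using finite_dom_ran(1)[OF dom] \<open>finite us\<close> disj by (rule card_Un_disjoint)
  have "near ?H (Suc r) u z" if u: "u \<in> us" for u
  proof -
    obtain v where "{u, v} \<in> ?H" "fst \<sigma> v = Some z" using new_us[OF u] by blast
    then have "near ?H (Suc 0 + r) u z" using near_trans[OF near_edge] cl by blast
    then show ?thesis by simp
  qed
  moreover have "u < n" if u: "u \<in> us" for u
    using new_us[OF u] E_edge by blast
  ultimately have nw': "u < n \<and> y \<in> insert z Z \<and> near ?H (Suc r) u y"
    if "snd \<sigma>' u = Some y" for u y
    using that nw by (auto simp: \<sigma>'_def split: if_splits)
  have spanned': "near ?H (2 * r + 1) u v"
    if uv: "{u, v} \<in> E" "fst \<sigma> v = Some y" "y \<in> insert z Z" "snd \<sigma>' u = None" for u v y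
  proof -
    have u: "snd \<sigma> u = None" "u \<notin> us" using uv(4) by (auto simp: \<sigma>'_def split: if_splits)
    show ?thesis
    proof (cases "y \<in> Z")
      case True
      then show ?thesis using spanned uv u by blast
    next
      case False
      then have "y = z" using uv by simp
      obtain w where "Edge u w \<in> set es"
        using collected_complete[of u v \<sigma> z] uv u \<open>y = z\<close> by (auto simp: es_def)
      then have "u \<in> source ` set es" by force
      from new[OF this] obtain v' where v': "{u, v'} \<in> ?H" "fst \<sigma> v' = Some z" by blast
      \<comment> \<open>The detour takes the offered edge to \<open>v'\<close>, then
        \<open>r\<close> steps to the center \<open>z\<close> and \<open>r\<close> steps back to
        \<open>v\<close>.\<close>
      have "near ?H (Suc 0 + (r + r)) u v"
        using near_trans[OF near_edge[OF v'(1)] near_trans[OF _ near_sym]]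
          cl[OF v'(2)] cl[of v z] uv(2) \<open>y = z\<close> by blast
      then show ?thesis by (simp add: mult_2)
    qed
  qed
  have "card (ran (snd \<sigma>')) * T \<le> g * card (dom (snd \<sigma>'))"
  proof (cases "us = {}")
    case True
    then have "snd \<sigma>' = snd \<sigma>" by (auto simp: \<sigma>'_def)
    with card show ?thesis by simp
  next
    case False
    then have us: "T \<le> length es" "us = source ` set es" by (auto simp: us_def split: if_splits)
    have "length es \<le> g * card us"
      using g
    proof
      assume "g = s"
      then show ?thesis using length_collected(1)[of \<sigma> z] us by (simp add: es_def)
    next
      assume "g = 1 \<and> (\<forall>u y. fst \<sigma> u = Some y \<longrightarrow> u = y)"
      then show ?thesis using length_collected(2)[of \<sigma> z] us by (auto simp: es_def)
    qed
    then have "T \<le> g * card us" using us by simp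
    \<comment> \<open>At most one new center arises, so a single \<open>T\<close> has to be paid,
      and the vertices in \<open>us\<close> pay it.\<close>
    moreover have "ran (snd \<sigma>') \<subseteq> insert z (ran (snd \<sigma>))"
      by (auto simp: \<sigma>'_def ran_def split: if_splits)
    then have "card (ran (snd \<sigma>')) \<le> card (insert z (ran (snd \<sigma>)))"
      using finite_dom_ran(2)[OF dom] by (intro card_mono) auto
    then have "card (ran (snd \<sigma>')) \<le> Suc (card (ran (snd \<sigma>)))"
      using finite_dom_ran(2)[OF dom] by (simp add: card_insert_if split: if_splits)
    then have "card (ran (snd \<sigma>')) * T \<le> Suc (card (ran (snd \<sigma>))) * T" by (rule mult_le_mono1)
    ultimately show ?thesis
      using card unfolding card_dom by (simp add: distrib_left)
  qed
  with nw' spanned' cl HE edges_of_collected show "scan_inv r g T (insert z Z) \<sigma>' ?H"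
    unfolding scan_inv_def es_def by (auto simp: \<sigma>'_def)
qed

text \<open>The difference \<open>n - card (dom (snd \<sigma>))\<close> acts as a potential: every
  captured vertex pays \<open>2 * s\<close> frames, \<open>s\<close> for its offers and
  \<open>s\<close> for its broadcast. Each visited center pays the remaining
  \<open>s + T\<close>.\<close>

lemma okp_scan:
  assumes "scan_inv r g T Z \<sigma> H" "set zs \<subseteq> {..<n}"
    and "g = s \<or> g = 1 \<and> (\<forall>u y. fst \<sigma> u = Some y \<longrightarrow> u = y)"
    and "\<And>\<sigma>' H'. fst \<sigma>' = fst \<sigma> \<Longrightarrow> H \<subseteq> H' \<Longrightarrow> scan_inv r g T (Z \<union> set zs) \<sigma>' H' \<Longrightarrow> okp X S N (f \<sigma>' H') \<sigma>'"
  shows "okp X S (length zs * (s + T) + 2 * s * (n - card (dom (snd \<sigma>))) + N) (scan T f zs \<sigma> H) \<sigma>"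
  using assms
proof (induction zs arbitrary: \<sigma> H Z)
  case Nil
  then have "okp X S N (f \<sigma> H) \<sigma>" by simp
  then show ?case by (auto elim: okp_mono)
next
  case (Cons z zs)
  let ?es = "collected \<sigma> z"
  let ?us = "if T \<le> length ?es then source ` set ?es else {}"
  let ?\<sigma> = "(fst \<sigma>, \<lambda>u. if u \<in> ?us then Some z else snd \<sigma> u)"
  let ?H = "H \<union> edges_of ?es"
  have z: "z < n" using Cons.prems by simp
  note step = scan_inv_step[OF Cons.prems(1) z Cons.prems(3)]
  have "okp X S (length zs * (s + T) + 2 * s * (n - card (dom (snd ?\<sigma>))) + N) (scan T f zs ?\<sigma> ?H) ?\<sigma>"
  proof (rule Cons.IH[OF step(1)])
    fix \<sigma>' H' assume "fst \<sigma>' = fst ?\<sigma>" "?H \<subseteq> H'" "scan_inv r g T (insert z Z \<union> set zs) \<sigma>' H'"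
    then show "okp X S N (f \<sigma>' H') \<sigma>'" using Cons.prems(4)[of \<sigma>' H'] by simp
  qed (use Cons.prems in auto)
  from okp_scan_Cons[OF z this]
  show ?case
  proof (rule okp_mono)
    have "dom (snd ?\<sigma>) \<subseteq> {..<n}"
      using step(1) unfolding scan_inv_def by (auto simp del: snd_conv)
    from finite_dom_ran(3)[OF this] step(2)
    have "n - card (dom (snd \<sigma>)) = card ?us + (n - card (dom (snd ?\<sigma>)))"
      by simp
    then show "s + T + 2 * s * card ?us +
        (length zs * (s + T) + 2 * s * (n - card (dom (snd ?\<sigma>))) + N)
        \<le> length (z # zs) * (s + T) + 2 * s * (n - card (dom (snd \<sigma>))) + N"
      by (simp only: add_mult_distrib2 length_Cons mult_Suc)
  qed
qed

section \<open>Levels and the shrinking of the clusterings\<close>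

definition cluster_bound :: "nat \<Rightarrow> real" where
  "cluster_bound r = (if r = 0 then real n else real n / (real s * q ^ r))"

text \<open>For \<open>r = 0\<close>, truncated subtraction gives the placeholder clustering the
  bounds of level 0. The edge condition names only \<open>u\<close>, but covers \<open>v\<close> too
  because \<open>{u, v} = {v, u}\<close>.\<close>

definition level_inv :: "nat \<Rightarrow> clusterings \<Rightarrow> nat set set \<Rightarrow> bool" where
  "level_inv r \<sigma> H \<longleftrightarrow> H \<subseteq> E \<and>
     (\<forall>u z. fst \<sigma> u = Some z \<longrightarrow> z < n \<and> near H (r - 1) u z) \<and>
     (\<forall>u z. snd \<sigma> u = Some z \<longrightarrow> z < n \<and> near H r u z) \<and>
     (\<forall>u v. {u, v} \<in> E \<longrightarrow>
        near H (2 * k - 1) u v \<or> u \<in> dom (fst \<sigma>) \<and> u \<in> dom (snd \<sigma>)) \<and>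
     (r = 0 \<longrightarrow> snd \<sigma> = ident n) \<and>
     real (card (ran (fst \<sigma>))) \<le> cluster_bound (r - 1) \<and>
     real (card (ran (snd \<sigma>))) \<le> cluster_bound r"

lemma threshold_le: "m > 0 \<Longrightarrow> real m * real (threshold m) \<le> real s * real n * q + real m"
proof -
  assume m: "m > 0"
  have "real (threshold m) \<le> real s * real n * q / real m + 1"
    using q_ge_1 by (simp add: threshold_def)
  then have "real m * real (threshold m) \<le> real m * (real s * real n * q / real m + 1)"
    by (rule mult_left_mono) simp
  also have "\<dots> = real s * real n * q + real m" using m by (simp add: field_simps)
  finally show ?thesis .
qed

lemma threshold_ge: "m > 0 \<Longrightarrow> real s * real n * q \<le> real m * real (threshold m)"
proof -
  assume m: "m > 0"
  have "real s * real n * q / real m \<le> real (threshold m)"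
    unfolding threshold_def by (rule real_nat_ceiling_ge)
  then show ?thesis using m by (simp add: field_simps)
qed

text \<open>The six units of \<open>s * n * q\<close> in \<open>level_cost\<close>: one for the
  broadcast of \<open>Next\<close>, one for the counts, two for offers below the threshold (one of
  them due to rounding up), and two for captured vertices.\<close>

lemma scan_cost_le:
  assumes "m \<le> n"
  shows "s + (m * (s + threshold m) + 2 * s * n) \<le> level_cost"
proof -
  have n: "n > 0" using s_pos s_le by simp
  have sn: "real s * real n \<le> real s * real n * q"
    using mult_left_mono[OF q_ge_1, of "real s * real n"] by simp
  have "real s \<le> real s * real n" "real n \<le> real s * real n"
    using n s_pos by (simp_all add: mult_le_cancel_left1 mult_le_cancel_right1)
  moreover have "real m \<le> real n" using assms by simp
  moreover from this have "real m * real s \<le> real s * real n"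
    by (subst mult.commute) (rule mult_left_mono, simp_all)
  moreover have "real m * real (threshold m) \<le> real s * real n * q + real m"
    using threshold_le[of m] q_ge_1 by (cases "m = 0") auto
  ultimately have "real (s + (m * (s + threshold m) + 2 * s * n)) \<le> 6 * (real s * real n * q)"
    using sn by (simp add: distrib_left)
  then show ?thesis unfolding level_cost_def by (intro le_nat_floor) (simp add: mult.assoc)
qed

text \<open>As \<open>m * threshold m\<close> is at least \<open>s * n * q\<close>, the second
  premise gives \<open>a \<le> m * g / (s * q)\<close>: a factor \<open>1 / (s * q)\<close> on the
  first level and \<open>1 / q\<close> afterwards.\<close>

lemma cluster_bound_Suc:
  assumes m: "real m \<le> cluster_bound r" "a * threshold m \<le> g * n" "m = 0 \<Longrightarrow> a = 0"
    and g: "g = (if r = 0 then 1 else s)"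
  shows "real a \<le> cluster_bound (Suc r)"
proof (cases "m = 0")
  \<comment> \<open>Without centers the threshold is 0, by the convention for division by zero, so
    only the third premise gives information.\<close>
  case True
  then show ?thesis using assms(3) q_ge_1 by (simp add: cluster_bound_def)
next
  case False
  have n: "n > 0" using s_pos s_le by simp
  have "real a * (real s * real n * q) \<le> real a * (real m * real (threshold m))"
    using threshold_ge[of m] False by (intro mult_left_mono) auto
  also have "\<dots> = real m * real (a * threshold m)" by simp
  also have "\<dots> \<le> real m * real (g * n)"
    using assms(2) by (intro mult_left_mono of_nat_mono) auto
  also have "\<dots> \<le> cluster_bound r * real (g * n)"
    using m(1) by (intro mult_right_mono) auto
  finally have "real a * (real s * q) * real n \<le> cluster_bound r * real g * real n"
    by (simp add: mult_ac)
  then have "real a * (real s * q) \<le> cluster_bound r * real g" using n by simp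
  then have "real a \<le> cluster_bound r * real g / (real s * q)"
    using s_pos q_ge_1 by (simp add: pos_le_divide_eq)
  also have "\<dots> = cluster_bound (Suc r)"
    using s_pos q_ge_1 g by (auto simp: cluster_bound_def field_simps)
  finally show ?thesis .
qed

text \<open>An edge not yet spanned has both ends clustered. The scan visits all centers, in
  particular that of \<open>v\<close>; if \<open>u\<close> is still not captured, the edge has
  stretch \<open>2 * r + 1\<close>, which is at most \<open>2 * k - 1\<close>.\<close>

lemma okp_level:
  assumes inv: "level_inv r \<sigma> H" and r: "Suc r \<le> k"
    and ok: "\<And>\<sigma>' H'. level_inv (Suc r) \<sigma>' H' \<Longrightarrow> okp X S N (f \<sigma>' H') \<sigma>'"
  shows "okp X S (level_cost + N) (bcast Next (scan (threshold (card (ran (snd \<sigma>)))) f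
     (sorted_list_of_set (ran (snd \<sigma>))) (upd Next \<sigma>) H)) \<sigma>"
proof -
  define m where "m = card (ran (snd \<sigma>))"
  define g where "g = (if r = 0 then 1 else s)"
  let ?T = "threshold m"
  have HE: "H \<subseteq> E" and cl: "\<And>u z. snd \<sigma> u = Some z \<Longrightarrow> z < n \<and> near H r u z"
    and edge: "\<And>u v. {u, v} \<in> E \<Longrightarrow> near H (2 * k - 1) u v \<or> u \<in> dom (snd \<sigma>)"
    and m_le: "real m \<le> cluster_bound r" and r0: "r = 0 \<Longrightarrow> snd \<sigma> = ident n"
    using inv unfolding level_inv_def m_def by blast+
  have ran: "ran (snd \<sigma>) \<subseteq> {..<n}" using cl by (auto simp: ran_def)
  then have fin: "finite (ran (snd \<sigma>))" by (rule finite_subset) simp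
  have "m \<le> n" using card_mono[OF _ ran] by (simp add: m_def)
  have "scan_inv r g ?T {} (upd Next \<sigma>) H"
    using HE cl by (simp add: scan_inv_def)
  then have "okp X S (length (sorted_list_of_set (ran (snd \<sigma>))) * (s + ?T)
      + 2 * s * (n - card (dom (snd (upd Next \<sigma>)))) + N)
      (scan ?T f (sorted_list_of_set (ran (snd \<sigma>))) (upd Next \<sigma>) H) (upd Next \<sigma>)"
  proof (rule okp_scan)
    show "set (sorted_list_of_set (ran (snd \<sigma>))) \<subseteq> {..<n}" using ran fin by simp
    \<comment> \<open>At level 0 the clusters are singletons, which permits
      \<open>g = 1\<close>.\<close>
    show "g = s \<or> g = 1 \<and> (\<forall>u y. fst (upd Next \<sigma>) u = Some y \<longrightarrow> u = y)"
      using r0 by (auto simp: g_def ident_def split: if_splits)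
    fix \<sigma>' H'
    assume fst': "fst \<sigma>' = fst (upd Next \<sigma>)" and H': "H \<subseteq> H'"
      and "scan_inv r g ?T ({} \<union> set (sorted_list_of_set (ran (snd \<sigma>)))) \<sigma>' H'"
    then have inv': "scan_inv r g ?T (ran (snd \<sigma>)) \<sigma>' H'" using fin by simp
    have nw': "u < n \<and> z \<in> ran (snd \<sigma>) \<and> near H' (Suc r) u z" if "snd \<sigma>' u = Some z" for u z
      using inv' that by (simp add: scan_inv_def)
    have spanned: "near H' (2 * r + 1) u v"
      if "{u, v} \<in> E" "snd \<sigma> v = Some z" "snd \<sigma>' u = None" for u v z
      using inv' that fst' ranI[of "snd \<sigma>" v z] unfolding scan_inv_def by fastforce
    have "near H' (2 * k - 1) u v \<or> u \<in> dom (fst \<sigma>') \<and> u \<in> dom (snd \<sigma>')" if uv: "{u, v} \<in> E" for u v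
    proof (cases "near H (2 * k - 1) u v")
      case True
      then show ?thesis using near_mono[OF _ H'] by blast
    next
      case False
      then have "\<not> near H (2 * k - 1) v u" using near_sym by blast
      then have u: "u \<in> dom (snd \<sigma>)" and v: "v \<in> dom (snd \<sigma>)"
        using edge[of u v] edge[of v u] uv False by (auto simp: insert_commute)
      show ?thesis
      proof (cases "snd \<sigma>' u")
        case None
        with spanned[OF uv] v have "near H' (2 * r + 1) u v" by blast
        then have "near H' (2 * k - 1) u v" using r by (elim near_le) simp
        then show ?thesis ..
      next
        case (Some z)
        then show ?thesis using u fst' by auto
      qed
    qed
    moreover have "real (card (ran (snd \<sigma>'))) \<le> cluster_bound (Suc r)"
    proof (rule cluster_bound_Suc[OF m_le _ _ g_def])
      have "dom (snd \<sigma>') \<subseteq> {..<n}" using nw' by auto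
      then have "card (dom (snd \<sigma>')) \<le> n" by (rule finite_dom_ran)
      then have "g * card (dom (snd \<sigma>')) \<le> g * n" by simp
      moreover have "card (ran (snd \<sigma>')) * ?T \<le> g * card (dom (snd \<sigma>'))"
        using inv' by (simp add: scan_inv_def)
      ultimately show "card (ran (snd \<sigma>')) * ?T \<le> g * n" by (rule order_trans[rotated])
      assume "m = 0"
      then have "ran (snd \<sigma>) = {}" using fin by (simp add: m_def)
      then have "ran (snd \<sigma>') = {}" using nw' by (auto simp: ran_def)
      then show "card (ran (snd \<sigma>')) = 0" by simp
    qed
    moreover have "fst \<sigma>' u = Some z \<longrightarrow> z < n \<and> near H' r u z" for u z
      using cl[of u z] fst' near_mono[OF _ H'] by auto
    moreover have "snd \<sigma>' u = Some z \<longrightarrow> z < n \<and> near H' (Suc r) u z" for u z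
      using nw'[of u z] ran by auto
    moreover have "H' \<subseteq> E" using inv' by (simp add: scan_inv_def)
    ultimately have "level_inv (Suc r) \<sigma>' H'"
      using m_le fst' unfolding level_inv_def by (simp add: m_def)
    then show "okp X S N (f \<sigma>' H') \<sigma>'" by (rule ok)
  qed
  then have "okp X S (s + (m * (s + ?T) + 2 * s * n + N)) (bcast Next (scan ?T f
     (sorted_list_of_set (ran (snd \<sigma>))) (upd Next \<sigma>) H)) \<sigma>"
    by (intro okp_bcast) (simp_all add: m_def)
  then show ?thesis
    unfolding m_def[symmetric] using scan_cost_le[OF \<open>m \<le> n\<close>] by (elim okp_mono) simp
qed

lemma okp_levels:
  assumes "level_inv r \<sigma> H" "r + m \<le> k"
    and "\<And>\<sigma>' H'. level_inv (r + m) \<sigma>' H' \<Longrightarrow> okp X S N (f \<sigma>' H') \<sigma>'"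
  shows "okp X S (m * level_cost + N) (levels m f \<sigma> H) \<sigma>"
  using assms
proof (induction m arbitrary: r \<sigma> H)
  case 0
  then show ?case by simp
next
  case (Suc m)
  have "okp X S (level_cost + (m * level_cost + N)) (levels (Suc m) f \<sigma> H) \<sigma>"
    unfolding levels.simps
  proof (rule okp_level[OF Suc.prems(1)])
    fix \<sigma>' H' assume "level_inv (Suc r) \<sigma>' H'"
    then show "okp X S (m * level_cost + N) (levels m f \<sigma>' H') \<sigma>'"
      using Suc.prems(2,3) by (intro Suc.IH[of "Suc r"]) auto
  qed (use Suc.prems in simp)
  then show ?case by (simp add: add.assoc)
qed

section \<open>Linking two clusterings\<close>

lemma answer_Link:
  assumes "links k \<sigma> a b F \<noteq> {}"
  obtains u v where "answer k \<sigma> (Link a b) F = Edge u v" "(u, v) \<in> links k \<sigma> a b F"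
proof -
  obtain u v where uv: "(SOME e. e \<in> links k \<sigma> a b F) = (u, v)" by fastforce
  moreover have "(SOME e. e \<in> links k \<sigma> a b F) \<in> links k \<sigma> a b F"
    using assms by (simp add: some_in_eq)
  ultimately show ?thesis using assms that by simp
qed

lemma answer_LinkD:
  assumes "answer k \<sigma> (Link a b) F = Edge u v"
  shows "(u, v) \<in> links k \<sigma> a b F"
proof -
  have ne: "links k \<sigma> a b F \<noteq> {}" using assms by auto
  show ?thesis by (rule answer_Link[OF ne]) (use assms in auto)
qed

text \<open>Both levels are positive, so both bounds carry a factor \<open>1 / s\<close> and their
  product is \<open>n^2 / (s^2 * q^(k-1))\<close>. Then \<open>q_power\<close> replaces one
  \<open>n\<close> by \<open>s^2 * q^k\<close>, which leaves \<open>n * q\<close>.\<close>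

lemma link_cost_le:
  assumes "i > 0" "j > 0" "i + j = k - 1" "real a \<le> cluster_bound i" "real b \<le> cluster_bound j"
  shows "s * (a * b) \<le> level_cost"
proof -
  have q: "q > 0" and s: "real s > 0" and n: "real n > 0" using q_ge_1 s_pos s_le by auto
  have k: "q ^ k = q * q ^ (k - 1)" using k_ge_3 by (simp flip: power_Suc)
  have "real (a * b) \<le> cluster_bound i * cluster_bound j"
    using assms by (simp add: mult_mono)
  also have "\<dots> = real n * real n / ((real s)\<^sup>2 * q ^ (k - 1))"
    using assms(1-3) by (simp add: cluster_bound_def power2_eq_square mult_ac flip: power_add)
  also have "\<dots> \<le> real n * ((real s)\<^sup>2 * q ^ k) / ((real s)\<^sup>2 * q ^ (k - 1))"
    using q_power q s by (intro divide_right_mono mult_left_mono) auto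
  also have "\<dots> = real n * q" using q s by (simp add: k)
  finally have "real s * real (a * b) \<le> real s * (real n * q)"
    by (rule mult_left_mono) simp
  moreover have "0 \<le> real s * (real n * q)" using q by simp
  ultimately have "real (s * (a * b)) \<le> 6 * (real s * (real n * q))"
    by (simp only: of_nat_mult)
  then show ?thesis unfolding level_cost_def by (intro le_nat_floor) (simp add: mult.assoc)
qed

text \<open>An edge not yet spanned is replaced by the walk from \<open>u\<close> over the center
  \<open>a\<close> to \<open>x\<close>, along the link \<open>{x, y}\<close>, and over the center
  \<open>b\<close> to \<open>v\<close>. Its length is
  \<open>2 * i + 1 + 2 * j = 2 * k - 1\<close>.\<close>

lemma okp_link:
  assumes inv: "level_inv (k div 2) \<sigma> H"
  shows "okp X (is_spanner n (2 * k - 1) E) level_cost (link \<sigma> H) \<sigma>"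
proof -
  define j where "j = k div 2"
  define i where "i = (if even k then j - 1 else j)"
  have j: "j > 0" using k_ge_3 by (simp add: j_def)
  have i: "i > 0" "i + j = k - 1"
    using k_ge_3 by (auto simp: i_def j_def elim!: evenE oddE)
  define A where "A = ran (side k \<sigma>)"
  define B where "B = ran (snd \<sigma>)"
  have HE: "H \<subseteq> E" and nw: "\<And>u z. snd \<sigma> u = Some z \<Longrightarrow> z < n \<and> near H j u z"
    and B_le: "real (card B) \<le> cluster_bound j"
    using inv unfolding level_inv_def B_def j_def by blast+
  have sd: "z < n \<and> near H i u z" if "side k \<sigma> u = Some z" for u z
    using inv that unfolding level_inv_def side_def i_def j_def by (auto split: if_splits)
  have A_le: "real (card A) \<le> cluster_bound i"
    using inv unfolding level_inv_def side_def i_def j_def A_def by auto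
  have edge: "near H (2 * k - 1) u v \<or> u \<in> dom (side k \<sigma>) \<and> u \<in> dom (snd \<sigma>)"
    if "{u, v} \<in> E" for u v
    using inv that unfolding level_inv_def side_def by auto
  have AB: "A \<subseteq> {..<n}" "B \<subseteq> {..<n}" using sd nw by (auto simp: A_def B_def ran_def)
  then have fin: "finite A" "finite B" using finite_subset[OF _ finite_lessThan] by blast+
  let ?qs = "map (\<lambda>(i, a, b). (i, Link a b)) (List.product [0..<s]
    (List.product (sorted_list_of_set A) (sorted_list_of_set B)))"
  let ?es = "map (\<lambda>(i, q). answer k \<sigma> q (X i)) ?qs"
  let ?H = "H \<union> edges_of ?es"
  have es: "set ?es = (\<lambda>(i, a, b). answer k \<sigma> (Link a b) (X i)) ` ({..<s} \<times> A \<times> B)"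
    using fin by (simp add: image_image case_prod_unfold lessThan_atLeast0 del: answer.simps)
  have "is_spanner n (2 * k - 1) E ?H"
  proof (rule is_spannerI)
    have "{u, v} \<in> E" if mem: "Edge u v \<in> set ?es" for u v
    proof -
      obtain t where t: "Edge u v = (\<lambda>(i, a, b). answer k \<sigma> (Link a b) (X i)) t"
          "t \<in> {..<s} \<times> A \<times> B"
        using mem unfolding es by (rule imageE)
      obtain p a b where p: "t = (p, a, b)" by (cases t)
      then have "answer k \<sigma> (Link a b) (X p) = Edge u v" using t(1) by (simp only: prod.case)
      from answer_LinkD[OF this] have "{u, v} \<in> X p" by (simp add: links_def)
      moreover have "p < s" using t(2) p by simp
      ultimately
      show ?thesis by (auto simp: input_graph_def)
    qed
    then show "?H \<subseteq> E" using HE unfolding edges_of_def by blast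
    show "2 * k - 1 > 0" using k_ge_3 by simp
    fix u v assume uv: "{u, v} \<in> E"
    show "near ?H (2 * k - 1) u v"
    proof (cases "near H (2 * k - 1) u v")
      case True
      then show ?thesis by (rule near_mono) simp
    next
      case False
      then have "\<not> near H (2 * k - 1) v u" using near_sym by blast
      \<comment> \<open>\<open>edge\<close> controls its first argument, so it is applied in both
        orientations.\<close>
      then obtain a b where ab: "side k \<sigma> u = Some a" "snd \<sigma> v = Some b"
        using edge[of u v] edge[of v u] uv False by (auto simp: insert_commute)
      obtain p where p: "p < s" "{u, v} \<in> X p" using uv by (auto simp: input_graph_def)
      then have "links k \<sigma> a b (X p) \<noteq> {}" using ab by (auto simp: links_def)
      then obtain x y where xy: "answer k \<sigma> (Link a b) (X p) = Edge x y" "(x, y) \<in> links k \<sigma> a b (X p)"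
        by (rule answer_Link)
      have "a \<in> A" "b \<in> B" using ab by (auto simp: A_def B_def intro: ranI)
      then have "(p, a, b) \<in> {..<s} \<times> A \<times> B" using p(1) by simp
      then have "Edge x y \<in> set ?es" unfolding es by (rule rev_image_eqI) (simp only: xy(1) prod.case)
      then have "{x, y} \<in> ?H" unfolding edges_of_def by blast
      then have *: "near ?H (Suc 0) x y" by (rule near_edge)
      have old: "near ?H l u v" if "near H l u v" for l u v
        using that by (rule near_mono) simp
      have x: "side k \<sigma> x = Some a" "snd \<sigma> y = Some b" using xy(2) by (auto simp: links_def)
      have "near ?H (i + i) u x" using near_trans[OF _ near_sym] old sd ab(1) x(1) by blast
      moreover have "near ?H (j + j) y v" using near_trans[OF _ near_sym] old nw ab(2) x(2) by blast
      ultimately have "near ?H (i + i + (Suc 0 + (j + j))) u v" using near_trans * by blast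
      moreover have "i + i + (Suc 0 + (j + j)) = 2 * k - 1" using i(2) k_ge_3 by simp
      ultimately show ?thesis by simp
    qed
  qed
  then have "okp X (is_spanner n (2 * k - 1) E) 0 (Halt ?H) \<sigma>" by (rule okp_Halt)
  then have "okp X (is_spanner n (2 * k - 1) E) (length ?qs + 0) (link \<sigma> H) \<sigma>"
    unfolding link_def A_def[symmetric] B_def[symmetric]
  proof (intro okp_asks)
    fix i q assume "(i, q) \<in> set ?qs"
    then obtain a b where q: "i < s" "a \<in> A" "b \<in> B" "q = Link a b" using fin by auto
    have "bounded n (answer k \<sigma> (Link a b) (X i))"
    proof (cases "links k \<sigma> a b (X i) = {}")
      case False
      then obtain x y where "answer k \<sigma> (Link a b) (X i) = Edge x y" "(x, y) \<in> links k \<sigma> a b (X i)"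
        by (rule answer_Link)
      then show ?thesis using X_edge[OF q(1), of x y] by (simp add: links_def)
    qed simp
    then show "i < s \<and> q \<in> Collect (bounded n) \<and> answer k \<sigma> q (X i) \<in> Collect (bounded n) \<and>
        upd q \<sigma> = \<sigma>"
      using q AB by (auto simp del: answer.simps)
  qed
  moreover have "length ?qs \<le> level_cost"
    using link_cost_le[OF i(1) j i(2) A_le B_le] by (simp add: length_product)
  ultimately show ?thesis by (elim okp_mono) simp
qed

text \<open>Linking fits into the budget of one more level, and
  \<open>k div 2 + 1 \<le> k\<close>.\<close>

lemma okp_spanner_tree:
  "okp X (is_spanner n (2 * k - 1) E) (k * level_cost) spanner_tree (ident n, ident n)"
proof -
  have "ran (ident n) = {..<n}" by (auto simp: ran_def ident_def)
  moreover have "u \<in> dom (ident n)" if "{u, v} \<in> E" for u v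
    using E_edge[OF that] by (auto simp: ident_def)
  ultimately have "level_inv 0 (ident n, ident n) {}"
    by (auto simp: level_inv_def cluster_bound_def ident_def near_refl split: if_splits)
  then have "okp X (is_spanner n (2 * k - 1) E) (k div 2 * level_cost + level_cost)
      spanner_tree (ident n, ident n)"
    unfolding spanner_tree_def
  proof (rule okp_levels)
    fix \<sigma> H assume "level_inv (0 + k div 2) \<sigma> H"
    then show "okp X (is_spanner n (2 * k - 1) E) level_cost (link \<sigma> H) \<sigma>"
      by (intro okp_link) simp
  qed simp
  moreover have "k div 2 * level_cost + level_cost \<le> k * level_cost"
  proof -
    have "Suc (k div 2) * level_cost \<le> k * level_cost" using k_ge_3 by (intro mult_le_mono1) simp
    then show ?thesis by simp
  qed
  ultimately show ?thesis by (rule okp_mono)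
qed

end

section \<open>Encoding and cost\<close>

lemma card_bounded: "finite (Collect (bounded n))" "card (Collect (bounded n)) \<le> 8 * (n + 1)\<^sup>2"
proof -
  define code :: "msg \<Rightarrow> nat \<times> nat \<times> nat" where
    "code m = (case m of Count z \<Rightarrow> (0, z, 0) | Item z j \<Rightarrow> (1, z, j) | Link a b \<Rightarrow> (2, a, b)
       | Next \<Rightarrow> (3, 0, 0) | Capture u z \<Rightarrow> (4, u, z) | Number c \<Rightarrow> (5, c, 0)
       | Edge u v \<Rightarrow> (6, u, v) | Nothing \<Rightarrow> (7, 0, 0))" for m
  have inj: "inj_on code (Collect (bounded n))"
    by (rule inj_onI) (auto simp: code_def split: msg.splits)
  have sub: "code ` Collect (bounded n) \<subseteq> {..<8} \<times> {..n} \<times> {..n}"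
    by (auto simp: code_def split: msg.splits)
  show "finite (Collect (bounded n))"
    by (rule inj_on_finite[OF inj sub]) simp
  have "card (Collect (bounded n)) \<le> card ({..<8::nat} \<times> {..n} \<times> {..n})"
    by (rule card_inj_on_le[OF inj sub]) simp
  then show "card (Collect (bounded n)) \<le> 8 * (n + 1)\<^sup>2"
    by (simp add: power2_eq_square)
qed

lemma exists_encoding:
  assumes "finite A" "card A \<le> 2 ^ L"
  shows "\<exists>enc :: 'a \<Rightarrow> bool list. \<exists>dec. \<forall>m\<in>A. length (enc m) = L \<and> dec (enc m) = m"
proof -
  let ?B = "{bs :: bool list. set bs \<subseteq> UNIV \<and> length bs = L}"
  have "finite ?B" "card ?B = 2 ^ L"
    using finite_lists_length_eq[of "UNIV :: bool set" L] card_lists_length_eq[of "UNIV :: bool set" L]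
    by simp_all
  then obtain enc where enc: "inj_on enc A" "enc ` A \<subseteq> ?B"
    using inj_on_iff_card_le[OF assms(1), of ?B] assms(2) by auto
  then have "\<forall>m\<in>A. length (enc m) = L \<and> the_inv_into A enc (enc m) = m"
    by (auto simp: the_inv_into_f_f)
  then show ?thesis by blast
qed

lemma exists_spanner_protocol:
  assumes n: "n \<ge> 2" and s: "1 \<le> s" "s \<le> n" and k: "k \<ge> 3" and "p \<le> 1"
    and q: "q \<ge> 1" "real n \<le> (real s)\<^sup>2 * q ^ k"
  shows "\<exists>P N. computes_spanner n s (2 * k - 1) p P \<and> comm_cost n s P \<le> enat N \<and>
    real N \<le> 96 * log 2 (real n) * (real k * (real s * real n * q))"
proof -
  \<comment> \<open>This leaves room for \<open>8 * (n + 1)^2\<close> messages, which for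
    \<open>n \<ge> 2\<close> is at most \<open>n^3 * n^4 = n^7\<close>.\<close>
  define L where "L = nat \<lceil>7 * log 2 (real n)\<rceil>"
  have log: "log 2 (real n) \<ge> 1" using n by (simp add: le_log_iff)
  have "L > 0" using log by (simp add: L_def)
  have L_le: "real L \<le> 8 * log 2 (real n)"
  proof -
    have "real L \<le> 7 * log 2 (real n) + 1" using log by (simp add: L_def)
    then show ?thesis using log by simp
  qed
  have "card (Collect (bounded n)) \<le> 2 ^ L"
  proof -
    have "(2::nat) ^ 3 \<le> n ^ 3" using n by (rule power_mono) simp
    moreover have "n + 1 \<le> n\<^sup>2" using mult_le_mono1[OF n, of n] n unfolding power2_eq_square by linarith
    then have "(n + 1)\<^sup>2 \<le> (n\<^sup>2)\<^sup>2" by (rule power_mono) simp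
    ultimately have "8 * (n + 1)\<^sup>2 \<le> n ^ 3 * (n\<^sup>2)\<^sup>2" by (intro mult_le_mono) simp_all
    also have "\<dots> = n ^ 7" by (simp flip: power_mult power_add)
    finally have "real (8 * (n + 1)\<^sup>2) \<le> real n ^ 7" using of_nat_mono by fastforce
    also have "\<dots> = real n powr 7" using n by simp
    also have "\<dots> = 2 powr (log 2 (real n) * 7)" using n by (simp flip: powr_powr)
    also have "\<dots> = 2 powr (7 * log 2 (real n))" by (simp add: mult.commute)
    also have "\<dots> \<le> 2 powr real L" unfolding L_def by (intro powr_mono real_nat_ceiling_ge) simp
    also have "\<dots> = real (2 ^ L)" by (simp add: powr_realpow)
    finally have "8 * (n + 1)\<^sup>2 \<le> 2 ^ L" by (simp only: of_nat_le_iff)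
    with card_bounded(2)[of n] show ?thesis by simp
  qed
  from exists_encoding[OF card_bounded(1) this] obtain enc :: "msg \<Rightarrow> bool list" and dec
    where enc: "\<forall>m\<in>Collect (bounded n). length (enc m) = L \<and> dec (enc m) = m"
    by blast
  interpret clustering L s n k enc dec q
  proof
    show "s > 0" using s by simp
  qed (use \<open>L > 0\<close> enc s(2) k q in blast)+
  let ?N = "2 * L * (k * level_cost)"
  have runs: "Runs X (is_spanner n (2 * k - 1) (input_graph s X)) ?N spanner_tree (\<lambda>_. [])"
    if "X \<in> inputs n s" for X
  proof -
    interpret clustering_input L s n k enc dec q X using that by unfold_locales
    show ?thesis by (rule okp_runs[OF okp_spanner_tree])
  qed
  have "real level_cost \<le> 6 * (real s * real n * q)"
    unfolding level_cost_def using q(1) of_nat_floor[of "6 * real s * real n * q"]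
    by (simp add: mult.assoc)
  \<comment> \<open>A frame has \<open>2 * L\<close> bits with \<open>L\<close> at most
    \<open>8 * log 2 n\<close>, and \<open>level_cost\<close> brings the factor 6; together they
    give 96.\<close>
  then have "real ?N \<le> 2 * (8 * log 2 (real n)) * (real k * (6 * (real s * real n * q)))"
    unfolding of_nat_mult using L_le log by (intro mult_mono) auto
  also have "\<dots> = 96 * log 2 (real n) * (real k * (real s * real n * q))" by simp
  finally show ?thesis
    using tree_protocol_correct[OF runs \<open>p \<le> 1\<close>] by blast
qed

section \<open>Choice of the shrinking rate\<close>

theorem theorem4p7:
  fixes d :: nat
  shows "\<exists>(C::real) (c::nat). C > 0 \<and>
    (\<forall>(n::nat) (s::nat) (k::nat). n \<ge> 2 \<longrightarrow> 1 \<le> s \<longrightarrow> s \<le> n \<longrightarrow> k \<ge> 3 \<longrightarrow>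
      (\<exists>P. computes_spanner n s (2 * k - 1) (1 - 1 / real n ^ d) P \<and>
           ereal_of_enat (comm_cost n s P) \<le>
             ereal (C * log 2 (real n) ^ c *
               (real k * real s powr (1 - 2 / real k) * real n powr (1 + 1 / real k)
                + real s * real n * real k))))"
\<comment> \<open>The constants do not depend on \<open>d\<close>, since the protocol is
  deterministic and always correct.\<close>
proof (intro exI[of _ "96 :: real"] exI[of _ "1 :: nat"] conjI allI impI)
  fix n s k :: nat
  assume n: "n \<ge> 2" and s: "1 \<le> s" "s \<le> n" and k: "k \<ge> 3"
  define x where "x = real n / (real s)\<^sup>2"
  define y where "y = x powr (1 / real k)"
  \<comment> \<open>\<open>y\<close> solves \<open>n = s^2 * y^k\<close>. The maximum covers the
    case \<open>n < s^2\<close>, where \<open>q = 1\<close> and the cost falls under the summand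
    \<open>s * n * k\<close>.\<close>
  define q where "q = max 1 y"
  have "x > 0" using n s by (simp add: x_def)
  then have "y > 0" by (simp add: y_def)
  have "x = y ^ k"
    using \<open>x > 0\<close> \<open>y > 0\<close> k by (simp add: y_def powr_powr flip: powr_realpow)
  also have "\<dots> \<le> q ^ k" using \<open>y > 0\<close> by (intro power_mono) (simp_all add: q_def)
  finally have "real n \<le> (real s)\<^sup>2 * q ^ k" using s by (simp add: x_def field_simps)
  moreover have "q \<ge> 1" by (simp add: q_def)
  moreover have "1 - 1 / real n ^ d \<le> 1" by simp
  ultimately obtain P N where P: "computes_spanner n s (2 * k - 1) (1 - 1 / real n ^ d) P"
      "comm_cost n s P \<le> enat N"
    and N: "real N \<le> 96 * log 2 (real n) * (real k * (real s * real n * q))"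
    using exists_spanner_protocol[OF n s k] by blast
  have "real s * real n * y = real s powr (1 - 2 / real k) * real n powr (1 + 1 / real k)"
  proof -
    have "y = real n powr (1 / real k) / real s powr (2 / real k)"
      using n s by (simp add: y_def x_def powr_divide powr_powr flip: powr_numeral)
    then show ?thesis using n s by (simp add: powr_diff powr_add)
  qed
  moreover have "q \<le> y + 1" using \<open>y > 0\<close> by (simp add: q_def)
  then have "real s * real n * q \<le> real s * real n * (y + 1)" by (rule mult_left_mono) simp
  ultimately have "real k * (real s * real n * q) \<le>
      real k * (real s powr (1 - 2 / real k) * real n powr (1 + 1 / real k) + real s * real n)"
    by (intro mult_left_mono) (simp_all add: distrib_left)
  then have "96 * log 2 (real n) * (real k * (real s * real n * q)) \<le> 96 * log 2 (real n) *
      (real k * (real s powr (1 - 2 / real k) * real n powr (1 + 1 / real k) + real s * real n))"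
    by (rule mult_left_mono) (use n in simp)
  also have "\<dots> = 96 * log 2 (real n) ^ 1 *
      (real k * real s powr (1 - 2 / real k) * real n powr (1 + 1 / real k) + real s * real n * real k)"
    by (simp add: algebra_simps)
  finally have bound: "real N \<le> \<dots>" using N by linarith
  have "ereal_of_enat (comm_cost n s P) \<le> ereal_of_enat (enat N)"
    using P(2) by (simp only: ereal_of_enat_le_iff)
  also have "\<dots> \<le> ereal (96 * log 2 (real n) ^ 1 *
      (real k * real s powr (1 - 2 / real k) * real n powr (1 + 1 / real k) + real s * real n * real k))"
    using bound by simp
  finally show "\<exists>P. computes_spanner n s (2 * k - 1) (1 - 1 / real n ^ d) P \<and>
      ereal_of_enat (comm_cost n s P) \<le> ereal (96 * log 2 (real n) ^ 1 *
        (real k * real s powr (1 - 2 / real k) * real n powr (1 + 1 / real k)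
         + real s * real n * real k))"
    using P(1) by blast
qed simp

end
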